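(* Let $F:\mathbb{R}^n\to\mathbb{R}^m$ be continuously differentiable with Jacobian $F'$, and suppose that $x\mapsto F'(x)^\top F(x)$ and $x\mapsto F'(x)$ are Lipschitz continuous on $\mathbb{R}^n$ with constants $L_1$ and $L_2$. Let $C\in\mathbb{R}^{m\times r}$ with $r\le m$ have full column rank, with QR factorization $C=QR$ where $Q\in\mathbb{R}^{m\times r}$ has orthonormal columns and $R\in\mathbb{R}^{r\times r}$ is diagonal with positive diagonal entries. Let $x_0\in\mathbb{R}^n$ be a starting point. Then a steepest descent method with linesearch or trust-region, started at $x_0$ and applied to minimizing $\Psi(\cdot,\mu)$ with $\mu=\epsilon/(8r\delta)$, takes at most $$O\big(\epsilon^{-2}+\delta^2\epsilon^{-3}\big)$$ evaluations of $F$ and $F'$ to find an $\epsilon$ minimax critical point of the min-max problem $\min_{x\in\mathbb{R}^n}\max_{\|y\|_\infty\le\delta}\|F(x)-Cy\|^2$. Here $0<\epsilon\le 1$, $0<\delta\le\delta_{\max}$ for a fixed $\delta_{\max}$, and the constant implied by $O(\cdot)$ does not depend on $\epsilon$ or on $\delta\in(0,\delta_{\max}]$ (it may depend on $F$, $C$, $r$, $L_1$, $L_2$, $x_0$, $\delta_{\max}$ and the parameters of the method).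
   Context: $\|\cdot\|$ is the Euclidean norm, $\|\cdot\|_1$ the $\ell_1$ norm, $\|\cdot\|_\infty$ the max norm. Smoothing function: for $\mu>0$ let $\theta(t,\mu)=\sqrt{t^2+4\mu^2}$ and $$\Psi(x,\mu)=\|F(x)\|^2+2\delta\sum_{i=1}^r\theta\big((C^\top F(x))_i,\mu\big).$$ Linearization: $$\phi(x,s)=\|F(x)\|^2+2\big(F'(x)^\top F(x)\big)^\top s+2\delta\,\|C^\top(F(x)+F'(x)s)\|_1,\qquad s\in\mathbb{R}^n.$$ A pair $(\hat x,\hat y)\in\mathbb{R}^n\times\mathbb{R}^r$ with $\|\hat y\|_\infty\le\delta$ is an $\epsilon$ minimax critical point of $\min_x\max_{\|y\|_\infty\le\delta}\|F(x)-Cy\|^2$ if $$\phi(\hat x,0)-\min_{\|s\|\le 1}\phi(\hat x,s)\le\epsilon\qquad\text{and}\qquad \hat y\in\mathop{\mathrm{argmax}}_{\|y\|_\infty\le\delta}\|C^\top(F(\hat x)-Cy)\|.$$ A steepest descent method with linesearch or trust-region means a standard iteration $x_{k+1}=x_k-t_k\nabla_x\Psi(x_k,\mu)$ whose step lengths $t_k\geq 0$ are determined by a standard linesearch (sufficient decrease) or trust-region safeguard, stopped at the first iterate $\hat x=x_k$ with $\|\nabla_x\Psi(x_k,\mu)\|\le\epsilon/2$; all evaluations of $F$ and $F'$, including those made inside the safeguard, are counted. The component $\hat y$ is then obtained from $\hat x$ as a maximizer in the second condition above. *)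

theory Defs
  imports "HOL-Analysis.Analysis"
begin

definition gradient :: "(real ^ 'n \<Rightarrow> real) \<Rightarrow> real ^ 'n \<Rightarrow> real ^ 'n" where
  "gradient f x = (THE D. GDERIV f x :> D)"

definition norm1 :: "real ^ 'r \<Rightarrow> real" where
  "norm1 v = (\<Sum>i\<in>UNIV. \<bar>v $ i\<bar>)"

definition theta :: "real \<Rightarrow> real \<Rightarrow> real" where
  "theta t \<mu> = sqrt (t\<^sup>2 + 4 * \<mu>\<^sup>2)"

definition Psi :: "(real ^ 'n \<Rightarrow> real ^ 'm) \<Rightarrow> real ^ 'r ^ 'm \<Rightarrow> real \<Rightarrow> real ^ 'n \<Rightarrow> real \<Rightarrow> real" where
  "Psi F C \<delta> x \<mu> =
     (norm (F x))\<^sup>2 + 2 * \<delta> * (\<Sum>i\<in>UNIV. theta ((transpose C *v F x) $ i) \<mu>)"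

definition phi :: "(real ^ 'n \<Rightarrow> real ^ 'm) \<Rightarrow> (real ^ 'n \<Rightarrow> real ^ 'n ^ 'm) \<Rightarrow> real ^ 'r ^ 'm \<Rightarrow> real
    \<Rightarrow> real ^ 'n \<Rightarrow> real ^ 'n \<Rightarrow> real" where
  "phi F F' C \<delta> x s =
     (norm (F x))\<^sup>2 + (2 *\<^sub>R (transpose (F' x) *v F x)) \<bullet> s
       + 2 * \<delta> * norm1 (transpose C *v (F x + F' x *v s))"

text \<open>The infimum below is over the compact unit ball and of a continuous function, hence a minimum.\<close>

definition eps_minimax_critical :: "(real ^ 'n \<Rightarrow> real ^ 'm) \<Rightarrow> (real ^ 'n \<Rightarrow> real ^ 'n ^ 'm)
    \<Rightarrow> real ^ 'r ^ 'm \<Rightarrow> real \<Rightarrow> real \<Rightarrow> real ^ 'n \<Rightarrow> real ^ 'r \<Rightarrow> bool" where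
  "eps_minimax_critical F F' C \<delta> \<epsilon> xh yh \<longleftrightarrow>
     infnorm yh \<le> \<delta> \<and>
     phi F F' C \<delta> xh 0 - (INF s\<in>cball 0 1. phi F F' C \<delta> xh s) \<le> \<epsilon> \<and>
     is_arg_max (\<lambda>y. norm (transpose C *v (F xh - C *v y))) (\<lambda>y. infnorm y \<le> \<delta>) yh"

text \<open>
  Step length safeguards with their parameters.
  \<^item> \<open>Linesearch c \<beta>\<^sub>1 \<beta>\<^sub>2 \<gamma> \<alpha>\<^sub>0\<close>: Armijo constant \<open>c\<close>, range \<open>[\<beta>\<^sub>1, \<beta>\<^sub>2]\<close> of the backtracking factor,
    maximal expansion factor \<open>\<gamma>\<close> after an accepted step, first trial step length \<open>\<alpha>\<^sub>0\<close>.
  \<^item> \<open>TrustRegion \<eta>\<^sub>1 \<eta>\<^sub>2 \<gamma>\<^sub>1 \<gamma>\<^sub>2 \<gamma>\<^sub>3 \<kappa> \<Delta>\<^sub>0\<close>: acceptance thresholds \<open>\<eta>\<^sub>1\<close> and \<open>\<eta>\<^sub>2\<close> (successful and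
    very successful), radius factors \<open>\<gamma>\<^sub>1, \<gamma>\<^sub>2, \<gamma>\<^sub>3\<close>, bound \<open>\<kappa>\<close> on the norm of the model Hessians,
    initial radius \<open>\<Delta>\<^sub>0\<close>.
\<close>

datatype safeguard =
    Linesearch real real real real real
  | TrustRegion real real real real real real real

fun admissible :: "safeguard \<Rightarrow> bool" where
  "admissible (Linesearch c \<beta>1 \<beta>2 \<gamma> \<alpha>0) \<longleftrightarrow>
     0 < c \<and> c < 1 \<and> 0 < \<beta>1 \<and> \<beta>1 \<le> \<beta>2 \<and> \<beta>2 < 1 \<and> 1 \<le> \<gamma> \<and> 0 < \<alpha>0"
| "admissible (TrustRegion \<eta>1 \<eta>2 \<gamma>1 \<gamma>2 \<gamma>3 \<kappa> \<Delta>0) \<longleftrightarrow>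
     0 < \<eta>1 \<and> \<eta>1 \<le> \<eta>2 \<and> \<eta>2 < 1 \<and> 0 < \<gamma>1 \<and> \<gamma>1 \<le> \<gamma>2 \<and> \<gamma>2 < 1 \<and> 1 \<le> \<gamma>3 \<and> 0 \<le> \<kappa> \<and> 0 < \<Delta>0"

text \<open>
  One iteration is one trial step; a rejected trial is an iteration with \<open>t k = 0\<close>, so termination
  of an inner backtracking loop is not presupposed. Nothing is required of the safeguard at an
  iterate where the stopping test \<open>norm (gradient f (x k)) \<le> tol\<close> holds.

  The backtracking search tries the steps \<open>\<alpha> k\<close>. After acceptance the next search starts between
  the accepted step and \<open>\<gamma>\<close> times that step. (Restarting every search from a fixed step would cost
  a further factor logarithmic in the Lipschitz constant of the gradient.)
\<close>

definition linesearch_steps :: "real \<Rightarrow> real \<Rightarrow> real \<Rightarrow> real \<Rightarrow> real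
    \<Rightarrow> (real ^ 'n \<Rightarrow> real) \<Rightarrow> real \<Rightarrow> (nat \<Rightarrow> real ^ 'n) \<Rightarrow> (nat \<Rightarrow> real) \<Rightarrow> bool" where
  "linesearch_steps c \<beta>1 \<beta>2 \<gamma> \<alpha>0 f tol x t \<longleftrightarrow>
     (\<exists>\<alpha>. \<alpha> 0 = \<alpha>0 \<and>
       (\<forall>k. let g = gradient f (x k) in
          tol < norm g \<longrightarrow>
          (if f (x k - \<alpha> k *\<^sub>R g) \<le> f (x k) - c * \<alpha> k * (norm g)\<^sup>2
           then t k = \<alpha> k \<and> \<alpha> k \<le> \<alpha> (Suc k) \<and> \<alpha> (Suc k) \<le> \<gamma> * \<alpha> k
           else t k = 0 \<and> \<beta>1 * \<alpha> k \<le> \<alpha> (Suc k) \<and> \<alpha> (Suc k) \<le> \<beta>2 * \<alpha> k)))"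

text \<open>
  The model at \<open>x k\<close> is \<open>f (x k) + g \<bullet> s + s \<bullet> (H k *v s) / 2\<close>; \<open>pred \<tau>\<close> is its decrease for
  \<open>s = - \<tau> *\<^sub>R g\<close>. The trial step is the Cauchy step: the minimizer of the model along the steepest
  descent direction within the trust region. The case \<open>\<kappa> = 0\<close> is the linear model.
\<close>

definition trust_region_steps :: "real \<Rightarrow> real \<Rightarrow> real \<Rightarrow> real \<Rightarrow> real \<Rightarrow> real \<Rightarrow> real
    \<Rightarrow> (real ^ 'n \<Rightarrow> real) \<Rightarrow> real \<Rightarrow> (nat \<Rightarrow> real ^ 'n) \<Rightarrow> (nat \<Rightarrow> real) \<Rightarrow> bool" where
  "trust_region_steps \<eta>1 \<eta>2 \<gamma>1 \<gamma>2 \<gamma>3 \<kappa> \<Delta>0 f tol x t \<longleftrightarrow>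
     (\<exists>(\<Delta> :: nat \<Rightarrow> real) (H :: nat \<Rightarrow> real ^ 'n ^ 'n) (\<tau> :: nat \<Rightarrow> real). \<Delta> 0 = \<Delta>0 \<and>
       (\<forall>k. let g = gradient f (x k);
                pred = (\<lambda>\<tau>. \<tau> * (norm g)\<^sup>2 - \<tau>\<^sup>2 / 2 * (g \<bullet> (H k *v g)));
                \<rho> = (f (x k) - f (x k - \<tau> k *\<^sub>R g)) / pred (\<tau> k)
            in tol < norm g \<longrightarrow>
               transpose (H k) = H k \<and> onorm ((*v) (H k)) \<le> \<kappa> \<and>
               is_arg_max pred (\<lambda>\<tau>. 0 \<le> \<tau> \<and> norm (\<tau> *\<^sub>R g) \<le> \<Delta> k) (\<tau> k) \<and>
               t k = (if \<eta>1 \<le> \<rho> then \<tau> k else 0) \<and>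
               (if \<eta>2 \<le> \<rho> then \<Delta> k \<le> \<Delta> (Suc k) \<and> \<Delta> (Suc k) \<le> \<gamma>3 * \<Delta> k
                else if \<eta>1 \<le> \<rho> then \<gamma>2 * \<Delta> k \<le> \<Delta> (Suc k) \<and> \<Delta> (Suc k) \<le> \<Delta> k
                else \<gamma>1 * \<Delta> k \<le> \<Delta> (Suc k) \<and> \<Delta> (Suc k) \<le> \<gamma>2 * \<Delta> k)))"

fun safeguarded :: "safeguard \<Rightarrow> (real ^ 'n \<Rightarrow> real) \<Rightarrow> real \<Rightarrow> (nat \<Rightarrow> real ^ 'n) \<Rightarrow> (nat \<Rightarrow> real) \<Rightarrow> bool"
  where
  "safeguarded (Linesearch c \<beta>1 \<beta>2 \<gamma> \<alpha>0) = linesearch_steps c \<beta>1 \<beta>2 \<gamma> \<alpha>0"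
| "safeguarded (TrustRegion \<eta>1 \<eta>2 \<gamma>1 \<gamma>2 \<gamma>3 \<kappa> \<Delta>0) = trust_region_steps \<eta>1 \<eta>2 \<gamma>1 \<gamma>2 \<gamma>3 \<kappa> \<Delta>0"

definition steepest_descent_run :: "safeguard \<Rightarrow> (real ^ 'n \<Rightarrow> real) \<Rightarrow> real \<Rightarrow> real ^ 'n
    \<Rightarrow> (nat \<Rightarrow> real ^ 'n) \<Rightarrow> (nat \<Rightarrow> real) \<Rightarrow> bool" where
  "steepest_descent_run S f tol x0 x t \<longleftrightarrow>
     x 0 = x0 \<and> (\<forall>k. x (Suc k) = x k - t k *\<^sub>R gradient f (x k)) \<and> safeguarded S f tol x t"

definition stops_at :: "(real ^ 'n \<Rightarrow> real) \<Rightarrow> real \<Rightarrow> (nat \<Rightarrow> real ^ 'n) \<Rightarrow> nat \<Rightarrow> bool" where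
  "stops_at f tol x k \<longleftrightarrow>
     norm (gradient f (x k)) \<le> tol \<and> (\<forall>j<k. tol < norm (gradient f (x j)))"

text \<open>
  Evaluations of \<open>F\<close> and \<open>F'\<close> made up to the stopping test at iterate \<open>k\<close>: \<open>F\<close> and \<open>F'\<close> at the
  starting point, then \<open>F\<close> at every trial point, accepted or not, and \<open>F'\<close> at every accepted one.
\<close>

fun evaluations :: "(nat \<Rightarrow> real) \<Rightarrow> nat \<Rightarrow> nat" where
  "evaluations t 0 = 2"
| "evaluations t (Suc k) = evaluations t k + (if t k = 0 then 1 else 2)"

end

theory Submission
  imports Defs
begin

text \<open>
  Write \<open>f\<close> for the smoothed objective \<open>\<Psi>(\<cdot>, \<mu>)\<close>. The theorem combines three facts.

  A small gradient of \<open>f\<close> certifies criticality. Since \<open>\<theta>(t, \<mu>)\<close> is convex in \<open>t\<close> and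
  \<open>\<bar>t\<bar> \<le> \<theta>(t, \<mu>) \<le> \<bar>t\<bar> + 2\<mu>\<close>, the decrease of the nonsmooth linearization \<open>\<phi>\<close> along a step \<open>s\<close>
  exceeds \<open>- \<nabla>f(x) \<bullet> s\<close> by at most the smoothing error \<open>4r\<delta>\<mu>\<close>. The choice of \<open>\<mu>\<close> makes this error
  \<open>\<epsilon>/2\<close>, and the stopping test makes the other term at most \<open>\<epsilon>/2\<close> on the unit ball
  (\<open>eps_minimax_critical_of_small_gradient\<close>).

  The function \<open>f\<close> satisfies a descent inequality
  \<open>f(x + s) \<le> f(x) + \<nabla>f(x) \<bullet> s + L \<parallel>s\<parallel>\<^sup>2\<close> with \<open>L = A + D \<delta>\<^sup>2/\<epsilon>\<close>: the squared residual contributes to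
  \<open>A\<close>, and the curvature \<open>O(1/\<mu>)\<close> of \<open>\<theta>\<close>, multiplied by \<open>\<delta>\<close>, contributes \<open>\<delta>/\<mu> = O(\<delta>\<^sup>2/\<epsilon>)\<close>. This needs
  a bound on \<open>F'\<close>, which can fail to be bounded on the whole space: in the plane,
  \<open>F(x) = x exp(2 i sqrt x)\<close> for large real \<open>x\<close> has \<open>F'\<^sup>T F\<close> and \<open>F'\<close> Lipschitz and
  \<open>\<parallel>F'(x)\<parallel>\<close> of order \<open>sqrt x\<close>. It is bounded wherever \<open>F\<close> is
  (\<open>jacobian_bounded_where_residual_bounded\<close>), and \<open>F\<close> is bounded on the sublevel set
  of \<open>f(x0)\<close> because \<open>\<parallel>F\<parallel>\<^sup>2 \<le> f\<close>. So the inequality holds at points of that sublevel set, for steps of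
  length at most 1, with \<open>A\<close> and \<open>D\<close> independent of \<open>\<epsilon> \<le> 1\<close> and \<open>\<delta> \<le> \<delta>max\<close>. Accepted steps decrease
  \<open>f\<close>, so the iterates up to the stopping test stay in the sublevel set and this local version suffices.

  A safeguarded steepest descent method for a nonnegative function with this descent inequality
  reaches gradient norm \<open>tol\<close> within \<open>O(L/tol\<^sup>2)\<close> trials (\<open>steepest_descent_complexity\<close>). Accepted
  trials decrease \<open>f\<close> by a multiple of \<open>tol\<^sup>2/L\<close>. The step length (or radius) has a lower bound
  proportional to \<open>1/L\<close> (or \<open>tol/L\<close>), because small trials succeed. A rejection shrinks it by a fixed
  factor and an acceptance enlarges it by at most a fixed factor, so rejections are bounded by a multiple
  of the acceptances plus a term logarithmic in \<open>L/tol\<close> (\<open>trial_count_le\<close>). With \<open>tol = \<epsilon>/2\<close>,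
  \<open>L/tol\<^sup>2\<close> is \<open>O(1/\<epsilon>\<^sup>2 + \<delta>\<^sup>2/\<epsilon>\<^sup>3)\<close>.
\<close>

section \<open>Linear algebra and linearization\<close>

lemma norm_matrix_vector_le:
  fixes A :: "real ^ 'n ^ 'm"
  shows "norm (A *v v) \<le> norm A * norm v"
proof -
  have "norm (A *v v) \<le> L2_set (\<lambda>i. norm (A $ i) * norm v) UNIV"
    unfolding norm_vec_def[of "A *v v"]
    by (rule L2_set_mono) (simp_all add: matrix_vector_mul_component Cauchy_Schwarz_ineq2)
  also have "\<dots> = norm A * norm v"
    by (simp add: norm_vec_def[of A] L2_set_left_distrib)
  finally show ?thesis .
qed

lemma norm_transpose_vector_le:
  fixes A :: "real ^ 'n ^ 'm"
  shows "norm (transpose A *v w) \<le> norm A * norm w"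
proof (cases "transpose A *v w = 0")
  case False
  let ?z = "transpose A *v w"
  have "norm ?z * norm ?z = w \<bullet> (A *v ?z)"
    by (metis dot_lmul_matrix dot_square_norm power2_eq_square transpose_matrix_vector)
  also have "\<dots> \<le> norm w * (norm A * norm ?z)"
    by (rule order_trans[OF norm_cauchy_schwarz mult_left_mono[OF norm_matrix_vector_le]]) simp
  finally show ?thesis
    using False by (simp add: mult.commute mult.left_commute)
qed simp

text \<open>
  The mean value inequality on the ball of radius \<open>norm s\<close> around \<open>x\<close>, hence the constant \<open>L\<close> where
  integration along the segment would give \<open>L/2\<close>.
\<close>

lemma lipschitz_derivative_linearization:
  fixes f :: "'a::real_normed_vector \<Rightarrow> 'b::real_normed_vector"
  assumes deriv: "\<And>y. (f has_derivative f' y) (at y)"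
    and lip: "\<And>y h. norm (f' y h - f' x h) \<le> L * norm (y - x) * norm h"
    and "0 \<le> L"
  shows "norm (f (x + s) - f x - f' x s) \<le> L * (norm s)\<^sup>2"
proof -
  have "norm (f (x + s) - f x - f' x (x + s - x)) \<le> norm (x + s - x) * (L * norm s)"
  proof (rule differentiable_bound_linearization[where S = "cball x (norm s)"])
    show "x + t *\<^sub>R (x + s - x) \<in> cball x (norm s)" if "t \<in> {0..1}" for t :: real
      using that by (simp add: dist_norm mult_left_le_one_le)
    show "(f has_derivative f' y) (at y within cball x (norm s))" for y
      using deriv has_derivative_at_withinI by blast
    show "onorm (f' y - f' x) \<le> L * norm s" if "y \<in> cball x (norm s)" for y
    proof (rule onorm_bound)
      show "norm ((f' y - f' x) h) \<le> L * norm s * norm h" for h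
      proof -
        have "L * norm (y - x) * norm h \<le> L * norm s * norm h"
          using that \<open>0 \<le> L\<close> by (intro mult_right_mono mult_left_mono) (auto simp: dist_norm norm_minus_commute)
        with lip[of y h] show ?thesis by simp
      qed
    qed (use \<open>0 \<le> L\<close> in simp)
  qed simp
  then show ?thesis
    by (simp add: power2_eq_square mult_ac)
qed

lemma sum_abs_le_norm:
  fixes v :: "real ^ 'r"
  shows "(\<Sum>i\<in>UNIV. \<bar>v $ i\<bar>) \<le> real CARD('r) * norm v"
  using sum_bounded_above[of "UNIV :: 'r set" "\<lambda>i. \<bar>v $ i\<bar>" "norm v"]
  by (simp add: component_le_norm_cart)

section \<open>The smoothing of the absolute value\<close>

lemma theta_bounds:
  assumes "0 < \<mu>"
  shows "\<bar>t\<bar> \<le> theta t \<mu>" "theta t \<mu> \<le> \<bar>t\<bar> + 2 * \<mu>" "2 * \<mu> \<le> theta t \<mu>"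
proof -
  show "\<bar>t\<bar> \<le> theta t \<mu>"
    unfolding theta_def by (rule real_le_rsqrt) simp
  show "2 * \<mu> \<le> theta t \<mu>"
    unfolding theta_def by (rule real_le_rsqrt) (simp add: power_mult_distrib)
  show "theta t \<mu> \<le> \<bar>t\<bar> + 2 * \<mu>"
    unfolding theta_def using assms by (intro real_le_lsqrt) (auto simp: power2_sum power_mult_distrib)
qed

lemma theta_square: "theta t \<mu> * theta t \<mu> = t\<^sup>2 + 4 * \<mu>\<^sup>2"
  by (simp add: theta_def)

lemma theta_slope_le_1:
  assumes "0 < \<mu>"
  shows "\<bar>t / theta t \<mu>\<bar> \<le> 1"
  using theta_bounds[OF assms, of t] assms by (simp add: abs_divide)

lemma theta_has_derivative:
  assumes "0 < \<mu>"
  shows "((\<lambda>t. theta t \<mu>) has_real_derivative t / theta t \<mu>) (at t)"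
proof -
  have "0 < t\<^sup>2 + 4 * \<mu>\<^sup>2"
    using assms by (simp add: add_nonneg_pos)
  then show ?thesis
    unfolding theta_def by (auto intro!: derivative_eq_intros simp: field_simps)
qed

text \<open>
  The tangent bound for a convex function. Multiplied by \<open>\<theta>(t, \<mu>)\<close> it becomes the Cauchy--Schwarz
  inequality for the vectors \<open>(t, 2\<mu>)\<close> and \<open>(t + d, 2\<mu>)\<close>, whose norms are the two values of \<open>\<theta>\<close>.
\<close>

lemma theta_convex_lower:
  assumes "0 < \<mu>"
  shows "theta t \<mu> + t / theta t \<mu> * d \<le> theta (t + d) \<mu>"
proof -
  let ?a = "theta t \<mu>" and ?b = "theta (t + d) \<mu>"
  have pos: "0 < ?a" "0 < ?b"
    using theta_bounds(3)[OF assms, of t] theta_bounds(3)[OF assms, of "t + d"] assms by linarith+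
  have "(t * (t + d) + 4 * \<mu>\<^sup>2)\<^sup>2 \<le> (t\<^sup>2 + 4 * \<mu>\<^sup>2) * ((t + d)\<^sup>2 + 4 * \<mu>\<^sup>2)"
  proof -
    have "(t\<^sup>2 + 4 * \<mu>\<^sup>2) * ((t + d)\<^sup>2 + 4 * \<mu>\<^sup>2) - (t * (t + d) + 4 * \<mu>\<^sup>2)\<^sup>2 = (2 * \<mu> * d)\<^sup>2"
      by algebra
    then show ?thesis
      by (metis diff_ge_0_iff_ge zero_le_power2)
  qed
  also have "\<dots> = (?a * ?b)\<^sup>2"
    unfolding power_mult_distrib theta_square[symmetric] by (simp only: power2_eq_square)
  finally have "t * (t + d) + 4 * \<mu>\<^sup>2 \<le> ?a * ?b"
    using pos by (simp add: abs_le_square_iff[symmetric])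
  then have "?a * ?a + t * d \<le> ?a * ?b"
    unfolding theta_square by (simp add: power2_eq_square algebra_simps)
  then show ?thesis
    using pos by (simp add: field_simps)
qed

text \<open>
  The tangent of the concave square root at \<open>t\<^sup>2 + 4\<mu>\<^sup>2\<close> bounds the left side; in terms of the two values
  \<open>a\<close>, \<open>b\<close> of \<open>\<theta>\<close> this is \<open>2ab \<le> a\<^sup>2 + b\<^sup>2\<close>. The remainder is
  \<open>d\<^sup>2/(2 \<theta>(t, \<mu>))\<close>, and \<open>\<theta> \<ge> 2\<mu>\<close>. This is where the curvature \<open>1/\<mu>\<close> enters the complexity.
\<close>

lemma theta_quadratic_upper:
  assumes "0 < \<mu>"
  shows "theta (t + d) \<mu> \<le> theta t \<mu> + t / theta t \<mu> * d + d\<^sup>2 / (4 * \<mu>)"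
proof -
  let ?a = "theta t \<mu>" and ?b = "theta (t + d) \<mu>"
  have a: "2 * \<mu> \<le> ?a" "0 < ?a"
    using theta_bounds(3)[OF assms, of t] assms by linarith+
  have "2 * ?a * ?b \<le> ?a * ?a + ?b * ?b"
    using sum_squares_bound[of ?a ?b] by (simp add: power2_eq_square)
  also have "\<dots> = 2 * (?a * ?a) + 2 * t * d + d\<^sup>2"
    unfolding theta_square by (simp add: power2_eq_square algebra_simps)
  finally have "?b \<le> ?a + t / ?a * d + d\<^sup>2 / (2 * ?a)"
    using a by (simp add: field_simps power2_eq_square)
  moreover have "d\<^sup>2 / (2 * ?a) \<le> d\<^sup>2 / (4 * \<mu>)"
    using a assms by (intro divide_left_mono) auto
  ultimately show ?thesis by linarith
qed

section \<open>The gradient of the smoothed objective\<close>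

lemma gradient_eqI:
  assumes "GDERIV f x :> D"
  shows "gradient f x = D"
  unfolding gradient_def
proof (rule the_equality[where P = "\<lambda>D. GDERIV f x :> D", OF assms])
  fix E assume "GDERIV f x :> E"
  then have "(\<lambda>h. h \<bullet> E) = (\<lambda>h. h \<bullet> D)"
    using assms unfolding gderiv_def by (rule has_derivative_unique)
  then show "E = D"
    by (metis inner_commute vector_eq_rdot)
qed

text \<open>
  All estimates use the gradient through its inner products, which keeps the transposed Jacobian out of
  the later computations.
\<close>

lemma gradient_Psi_inner:
  fixes F :: "real ^ 'n \<Rightarrow> real ^ 'm" and C :: "real ^ 'r ^ 'm"
  assumes deriv: "\<And>x. (F has_derivative (\<lambda>h. F' x *v h)) (at x)" and "0 < \<mu>"
  shows "gradient (\<lambda>x. Psi F C \<delta> x \<mu>) x \<bullet> s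
    = 2 * (F x \<bullet> (F' x *v s))
      + 2 * \<delta> * (\<Sum>i\<in>UNIV. (transpose C *v F x) $ i / theta ((transpose C *v F x) $ i) \<mu>
          * (transpose C *v (F' x *v s)) $ i)"
proof -
  define w :: "real ^ 'r"
    where "w = (\<chi> i. (transpose C *v F x) $ i / theta ((transpose C *v F x) $ i) \<mu>)"
  define D where "D = 2 *\<^sub>R (transpose (F' x) *v F x) + (2 * \<delta>) *\<^sub>R (transpose (F' x) *v (C *v w))"
  have D: "D \<bullet> h = 2 * (F x \<bullet> (F' x *v h))
      + 2 * \<delta> * (\<Sum>i\<in>UNIV. w $ i * (transpose C *v (F' x *v h)) $ i)" for h
  proof -
    have "(C *v w) \<bullet> (F' x *v h) = (transpose C *v (F' x *v h)) \<bullet> w"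
      unfolding transpose_matrix_vector dot_lmul_matrix by (rule inner_commute)
    also have "\<dots> = (\<Sum>i\<in>UNIV. w $ i * (transpose C *v (F' x *v h)) $ i)"
      by (simp add: inner_vec_def mult.commute)
    finally show ?thesis
      by (simp add: D_def inner_add_left dot_lmul_matrix)
  qed
  have component: "bounded_linear (\<lambda>v. (transpose C *v v) $ i)" for i
    by (rule bounded_linear_compose[OF bounded_linear_vec_nth matrix_vector_mul_bounded_linear])
  have "((\<lambda>x. theta ((transpose C *v F x) $ i) \<mu>) has_derivative
      (\<lambda>h. (transpose C *v (F' x *v h)) $ i * w $ i)) (at x)" for i
    using DERIV_compose_FDERIV[OF theta_has_derivative[OF \<open>0 < \<mu>\<close>]
        bounded_linear.has_derivative[OF component deriv]]
    by (simp add: w_def)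
  then have "((\<lambda>x. F x \<bullet> F x + 2 * \<delta> * (\<Sum>i\<in>UNIV. theta ((transpose C *v F x) $ i) \<mu>)) has_derivative
      (\<lambda>h. (F x \<bullet> (F' x *v h) + (F' x *v h) \<bullet> F x)
        + 2 * \<delta> * (\<Sum>i\<in>UNIV. (transpose C *v (F' x *v h)) $ i * w $ i))) (at x)"
    by (intro has_derivative_add has_derivative_inner deriv has_derivative_mult_right has_derivative_sum)
  also have "(\<lambda>h. (F x \<bullet> (F' x *v h) + (F' x *v h) \<bullet> F x)
        + 2 * \<delta> * (\<Sum>i\<in>UNIV. (transpose C *v (F' x *v h)) $ i * w $ i)) = (\<lambda>h. h \<bullet> D)"
    by (rule ext, subst inner_commute[of _ D], subst D) (simp add: inner_commute mult.commute)
  finally have "GDERIV (\<lambda>x. Psi F C \<delta> x \<mu>) x :> D"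
    unfolding gderiv_def Psi_def power2_norm_eq_inner .
  from gradient_eqI[OF this] show ?thesis
    using D[of s] by (simp add: w_def)
qed

section \<open>Local descent\<close>

lemma lipschitz_matrix_vector:
  fixes A :: "'a::metric_space \<Rightarrow> real ^ 'n ^ 'm"
  assumes "L-lipschitz_on UNIV A"
  shows "norm (A y *v h - A x *v h) \<le> L * dist y x * norm h"
proof -
  have "norm (A y *v h - A x *v h) \<le> norm (A y - A x) * norm h"
    by (metis matrix_vector_mult_diff_rdistrib norm_matrix_vector_le)
  also have "\<dots> \<le> L * dist y x * norm h"
    using lipschitz_onD[OF assms, of y x] by (intro mult_right_mono) (auto simp: dist_norm)
  finally show ?thesis .
qed

text \<open>
  Compare \<open>F'\<^sup>T F\<close> at \<open>x\<close> and at \<open>x + v\<close> for a unit vector \<open>v\<close>. With \<open>u = F'(x) v\<close>, its change in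
  direction \<open>v\<close> is at most \<open>L1\<close>. It also equals \<open>\<parallel>u\<parallel>\<^sup>2\<close> up to terms that are at most linear in
  \<open>\<parallel>u\<parallel>\<close>, because \<open>F\<close> grows by nearly \<open>u\<close>, \<open>F'\<close> changes by at most \<open>L2\<close> and \<open>\<parallel>F(x)\<parallel> \<le> B\<close>. A quadratic
  bounded by a linear function bounds \<open>\<parallel>u\<parallel>\<close>.
\<close>

lemma jacobian_bounded_where_residual_bounded:
  fixes F :: "real ^ 'n \<Rightarrow> real ^ 'm"
  assumes deriv: "\<And>x. (F has_derivative (\<lambda>h. F' x *v h)) (at x)"
    and lip1: "L1-lipschitz_on UNIV (\<lambda>x. transpose (F' x) *v F x)"
    and lip2: "L2-lipschitz_on UNIV F'"
    and B: "norm (F x) \<le> B"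
  shows "norm (F' x *v v) \<le> (1 + 2 * L2 + L1 + L2 * B + L2\<^sup>2) * norm v"
proof -
  have L: "0 \<le> L1" "0 \<le> L2" "0 \<le> B"
    using lip1 lip2 B by (auto intro: lipschitz_on_nonneg order_trans[OF norm_ge_zero])
  note F'_lip = lipschitz_matrix_vector[OF lip2, of _ _ x, unfolded dist_norm]
  have unit: "norm (F' x *v v) \<le> 1 + 2 * L2 + L1 + L2 * B + L2\<^sup>2" if v: "norm v = 1" for v
  proof (rule ccontr)
    define u where "u = F' x *v v"
    define u' where "u' = F' (x + v) *v v"
    define e where "e = F (x + v) - F x - u"
    have e: "norm e \<le> L2"
      using lipschitz_derivative_linearization[of F "\<lambda>y h. F' y *v h" x L2 v, OF deriv F'_lip \<open>0 \<le> L2\<close>] v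
      by (simp add: e_def u_def)
    have du: "norm (u' - u) \<le> L2"
      using F'_lip[of "x + v" v] v by (simp add: u_def u'_def)
    have "u' \<bullet> F (x + v) - u \<bullet> F x
        = (transpose (F' (x + v)) *v F (x + v) - transpose (F' x) *v F x) \<bullet> v"
      unfolding u_def u'_def inner_diff_left transpose_matrix_vector dot_lmul_matrix
      by (simp add: inner_commute)
    also have "\<dots> \<le> L1"
      using lipschitz_onD[OF lip1, of "x + v" x] v
      by (intro order_trans[OF norm_cauchy_schwarz]) (auto simp: dist_norm)
    finally have *: "u' \<bullet> F (x + v) - u \<bullet> F x \<le> L1" .
    have Fv: "F (x + v) = F x + u + e"
      by (simp add: e_def)
    have "u' \<bullet> F (x + v) - u \<bullet> F x
        = (u' - u) \<bullet> F x + (u \<bullet> u + u \<bullet> e + (u' - u) \<bullet> u + (u' - u) \<bullet> e)"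
      unfolding Fv by (simp add: inner_diff_left inner_add_right algebra_simps)
    \<comment> \<open>Only \<open>u \<bullet> u\<close> is quadratic in \<open>u\<close>; the other four terms are errors.\<close>
    moreover have "\<bar>(u' - u) \<bullet> F x\<bar> \<le> L2 * B"
      by (rule order_trans[OF Cauchy_Schwarz_ineq2 mult_mono[OF du B]]) (use L in auto)
    moreover have "\<bar>u \<bullet> e\<bar> \<le> norm u * L2"
      by (rule order_trans[OF Cauchy_Schwarz_ineq2 mult_left_mono[OF e]]) simp
    moreover have "\<bar>(u' - u) \<bullet> u\<bar> \<le> L2 * norm u"
      by (rule order_trans[OF Cauchy_Schwarz_ineq2 mult_right_mono[OF du]]) simp
    moreover have "\<bar>(u' - u) \<bullet> e\<bar> \<le> L2 * L2"
      by (rule order_trans[OF Cauchy_Schwarz_ineq2 mult_mono[OF du e]]) (use L in auto)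
    ultimately have quad: "norm u * norm u \<le> L1 + L2 * B + 2 * L2 * norm u + L2\<^sup>2"
      using * unfolding dot_square_norm power2_eq_square mult.commute[of "norm u" L2] by linarith
    assume "\<not> ?thesis"
    then have big: "1 + 2 * L2 + L1 + L2 * B + L2\<^sup>2 < norm u"
      by (simp add: u_def)
    have nn: "0 \<le> L1 + L2 * B + L2\<^sup>2"
      using L by simp
    have "1 \<le> norm u"
      using big nn L by linarith
    have "(1 + 2 * L2 + (L1 + L2 * B + L2\<^sup>2)) * norm u < norm u * norm u"
      using \<open>1 \<le> norm u\<close> big by (intro mult_strict_right_mono) (auto simp: add.assoc)
    moreover have "(L1 + L2 * B + L2\<^sup>2) * 1 \<le> (L1 + L2 * B + L2\<^sup>2) * norm u"
      using \<open>1 \<le> norm u\<close> nn by (intro mult_left_mono)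
    ultimately show False
      using quad by (simp add: distrib_right) (use norm_ge_zero[of u] in linarith)
  qed
  show ?thesis
  proof (cases "v = 0")
    case False
    have "norm (F' x *v (v /\<^sub>R norm v)) \<le> 1 + 2 * L2 + L1 + L2 * B + L2\<^sup>2"
      using False by (intro unit) simp
    then show ?thesis
      using False by (simp add: matrix_vector_mult_scaleR field_simps)
  qed simp
qed

text \<open>
  The squared residual has the Lipschitz gradient \<open>2 F'\<^sup>T F\<close>. For the smoothed term, the quadratic bound
  on \<open>\<theta>\<close> is applied to the exact increment \<open>d = C\<^sup>T(F(x + s) - F(x))\<close>, whose norm is at most
  \<open>\<parallel>C\<parallel>(M + L2)\<parallel>s\<parallel>\<close> as \<open>\<parallel>s\<parallel> \<le> 1\<close>. The linear term in \<open>d\<close> differs from the gradient term by the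
  linearization error \<open>e\<close> of \<open>F\<close>, weighted by slopes of modulus at most 1. So a bound on \<open>F'\<close> at \<open>x\<close>
  suffices, and \<open>x + s\<close> may lie where neither \<open>F\<close> nor \<open>F'\<close> is under control.
\<close>

lemma Psi_local_descent:
  fixes F :: "real ^ 'n \<Rightarrow> real ^ 'm" and C :: "real ^ 'r ^ 'm"
  assumes deriv: "\<And>x. (F has_derivative (\<lambda>h. F' x *v h)) (at x)"
    and lip1: "L1-lipschitz_on UNIV (\<lambda>x. transpose (F' x) *v F x)"
    and lip2: "L2-lipschitz_on UNIV F'"
    and jac: "\<And>v. norm (F' x *v v) \<le> M * norm v"
    and "0 < \<mu>" "0 \<le> \<delta>" "norm s \<le> 1"
  shows "Psi F C \<delta> (x + s) \<mu> \<le> Psi F C \<delta> x \<mu> + gradient (\<lambda>x. Psi F C \<delta> x \<mu>) x \<bullet> s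
    + (2 * L1 + 2 * \<delta> * (real CARD('r) * norm C * L2 + (norm C * (M + L2))\<^sup>2 / (4 * \<mu>))) * (norm s)\<^sup>2"
proof -
  have L: "0 \<le> L1" "0 \<le> L2"
    using lip1 lip2 by (auto intro: lipschitz_on_nonneg)
  define u where "u = F' x *v s"
  define e where "e = F (x + s) - F x - u"
  define d where "d = transpose C *v (F (x + s) - F x)"
  define t where "t = transpose C *v F x"
  define w where "w i = t $ i / theta (t $ i) \<mu>" for i
  note F'_lip = lipschitz_matrix_vector[OF lip2, of _ _ x, unfolded dist_norm]
  have e: "norm e \<le> L2 * (norm s)\<^sup>2"
    using lipschitz_derivative_linearization[of F "\<lambda>y h. F' y *v h" x L2 s, OF deriv F'_lip \<open>0 \<le> L2\<close>]
    by (simp add: e_def u_def)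
  have "norm (F (x + s) \<bullet> F (x + s) - F x \<bullet> F x - 2 * ((transpose (F' x) *v F x) \<bullet> s))
      \<le> 2 * L1 * (norm s)\<^sup>2"
  proof (rule lipschitz_derivative_linearization[where f = "\<lambda>y. F y \<bullet> F y"
        and f' = "\<lambda>y h. 2 * ((transpose (F' y) *v F y) \<bullet> h)"])
    show "((\<lambda>y. F y \<bullet> F y) has_derivative (\<lambda>h. 2 * ((transpose (F' y) *v F y) \<bullet> h))) (at y)" for y
      using has_derivative_inner[OF deriv deriv, of y]
      unfolding transpose_matrix_vector dot_lmul_matrix
      by (simp add: inner_commute[of "F' y *v h" for h])
    show "norm (2 * ((transpose (F' y) *v F y) \<bullet> h) - 2 * ((transpose (F' x) *v F x) \<bullet> h))
        \<le> 2 * L1 * norm (y - x) * norm h" for y h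
    proof -
      have "\<bar>(transpose (F' y) *v F y - transpose (F' x) *v F x) \<bullet> h\<bar> \<le> (L1 * norm (y - x)) * norm h"
        using lipschitz_onD[OF lip1, of y x]
        by (intro order_trans[OF Cauchy_Schwarz_ineq2] mult_right_mono) (auto simp: dist_norm)
      then show ?thesis
        by (simp add: inner_diff_left abs_if split: if_splits)
    qed
  qed (use L in simp)
  then have square: "(norm (F (x + s)))\<^sup>2 \<le> (norm (F x))\<^sup>2 + 2 * (F x \<bullet> u) + 2 * L1 * (norm s)\<^sup>2"
    by (simp add: power2_norm_eq_inner dot_lmul_matrix u_def abs_le_iff)
  have d_eq: "d $ i = (transpose C *v u) $ i + (transpose C *v e) $ i" for i
    by (simp add: d_def e_def matrix_vector_mult_diff_distrib del: transpose_matrix_vector)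
  have d_norm: "norm d \<le> norm C * (M + L2) * norm s"
  proof -
    have "norm (F (x + s) - F x) \<le> norm u + norm e"
      by (metis add_diff_cancel diff_add_cancel e_def norm_triangle_ineq add.commute)
    also have "\<dots> \<le> M * norm s + L2 * norm s"
    proof (rule add_mono)
      have "L2 * (norm s)\<^sup>2 \<le> L2 * norm s"
        using L \<open>norm s \<le> 1\<close> by (intro mult_left_mono) (auto simp: power2_eq_square mult_left_le)
      with e show "norm e \<le> L2 * norm s" by linarith
    qed (simp add: u_def jac)
    finally have "norm C * norm (F (x + s) - F x) \<le> norm C * ((M + L2) * norm s)"
      by (intro mult_left_mono) (auto simp: distrib_right)
    then show ?thesis
      unfolding d_def using norm_transpose_vector_le[of C "F (x + s) - F x"] by (simp add: mult.assoc)
  qed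
  have point: "theta ((transpose C *v F (x + s)) $ i) \<mu>
      \<le> theta (t $ i) \<mu> + w i * (transpose C *v u) $ i + \<bar>(transpose C *v e) $ i\<bar> + (d $ i)\<^sup>2 / (4 * \<mu>)" for i
  proof -
    have "(transpose C *v F (x + s)) $ i = t $ i + d $ i"
      by (simp add: t_def d_def matrix_vector_mult_diff_distrib del: transpose_matrix_vector)
    then have "theta ((transpose C *v F (x + s)) $ i) \<mu> \<le> theta (t $ i) \<mu> + w i * d $ i + (d $ i)\<^sup>2 / (4 * \<mu>)"
      using theta_quadratic_upper[OF \<open>0 < \<mu>\<close>, of "t $ i" "d $ i"] by (simp add: w_def)
    moreover have "w i * (transpose C *v e) $ i \<le> \<bar>(transpose C *v e) $ i\<bar>"
    proof -
      have "\<bar>w i * (transpose C *v e) $ i\<bar> \<le> 1 * \<bar>(transpose C *v e) $ i\<bar>"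
        unfolding abs_mult using theta_slope_le_1[OF \<open>0 < \<mu>\<close>, of "t $ i"]
        by (intro mult_right_mono) (auto simp: w_def)
      then show ?thesis by linarith
    qed
    ultimately show ?thesis
      unfolding d_eq[of i] distrib_left by linarith
  qed
  have "(\<Sum>i\<in>UNIV. theta ((transpose C *v F (x + s)) $ i) \<mu>)
      \<le> (\<Sum>i\<in>UNIV. theta (t $ i) \<mu>) + (\<Sum>i\<in>UNIV. w i * (transpose C *v u) $ i)
        + (\<Sum>i\<in>UNIV. \<bar>(transpose C *v e) $ i\<bar>) + (\<Sum>i\<in>UNIV. (d $ i)\<^sup>2) / (4 * \<mu>)"
    using sum_mono[OF point] by (simp add: sum.distrib sum_divide_distrib)
  also have "(\<Sum>i\<in>UNIV. (d $ i)\<^sup>2) / (4 * \<mu>) \<le> (norm C * (M + L2))\<^sup>2 / (4 * \<mu>) * (norm s)\<^sup>2"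
  proof -
    have "(\<Sum>i\<in>UNIV. (d $ i)\<^sup>2) = (norm d)\<^sup>2"
      unfolding power2_norm_eq_inner by (simp add: inner_vec_def power2_eq_square)
    also have "\<dots> \<le> (norm C * (M + L2) * norm s)\<^sup>2"
      by (rule power_mono[OF d_norm]) simp
    finally show ?thesis
      using \<open>0 < \<mu>\<close> by (simp add: power_mult_distrib divide_right_mono)
  qed
  also have "(\<Sum>i\<in>UNIV. \<bar>(transpose C *v e) $ i\<bar>) \<le> real CARD('r) * norm C * L2 * (norm s)\<^sup>2"
  proof -
    have "real CARD('r) * norm (transpose C *v e) \<le> real CARD('r) * (norm C * (L2 * (norm s)\<^sup>2))"
      by (intro mult_left_mono order_trans[OF norm_transpose_vector_le] e) auto
    from order_trans[OF sum_abs_le_norm this] show ?thesis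
      by (simp only: mult.assoc)
  qed
  finally have theta: "(\<Sum>i\<in>UNIV. theta ((transpose C *v F (x + s)) $ i) \<mu>)
      \<le> (\<Sum>i\<in>UNIV. theta (t $ i) \<mu>) + (\<Sum>i\<in>UNIV. w i * (transpose C *v u) $ i)
        + (real CARD('r) * norm C * L2 + (norm C * (M + L2))\<^sup>2 / (4 * \<mu>)) * (norm s)\<^sup>2"
    by (simp add: distrib_right)
  have "gradient (\<lambda>x. Psi F C \<delta> x \<mu>) x \<bullet> s
      = 2 * (F x \<bullet> u) + 2 * \<delta> * (\<Sum>i\<in>UNIV. w i * (transpose C *v u) $ i)"
    unfolding gradient_Psi_inner[OF deriv \<open>0 < \<mu>\<close>] t_def u_def w_def ..
  moreover have "2 * \<delta> * (\<Sum>i\<in>UNIV. theta ((transpose C *v F (x + s)) $ i) \<mu>)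
      \<le> 2 * \<delta> * (\<Sum>i\<in>UNIV. theta (t $ i) \<mu>) + 2 * \<delta> * (\<Sum>i\<in>UNIV. w i * (transpose C *v u) $ i)
        + 2 * \<delta> * (real CARD('r) * norm C * L2 + (norm C * (M + L2))\<^sup>2 / (4 * \<mu>)) * (norm s)\<^sup>2"
    using mult_left_mono[OF theta, of "2 * \<delta>"] \<open>0 \<le> \<delta>\<close>
    by (simp only: distrib_left mult.assoc[symmetric])
  ultimately show ?thesis
    using square unfolding Psi_def t_def distrib_right[of "2 * L1"] by linarith
qed

section \<open>Critical points\<close>

lemma max_residual_attained:
  fixes G :: "real ^ 'm" and C :: "real ^ 'r ^ 'm"
  assumes "0 \<le> \<delta>"
  shows "\<exists>y. is_arg_max (\<lambda>y. norm (transpose C *v (G - C *v y))) (\<lambda>y. infnorm y \<le> \<delta>) y"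
proof -
  let ?S = "{y :: real ^ 'r. infnorm y \<le> \<delta>}"
  have "bounded ?S"
  proof (rule boundedI)
    fix y :: "real ^ 'r" assume "y \<in> ?S"
    then show "norm y \<le> sqrt DIM(real ^ 'r) * \<delta>"
      by (intro order_trans[OF norm_le_infnorm] mult_left_mono) auto
  qed
  moreover have "closed ?S"
    by (intro closed_Collect_le continuous_intros)
  ultimately have "compact ?S"
    by (simp add: compact_eq_bounded_closed)
  moreover have "(0 :: real ^ 'r) \<in> ?S"
    using assms by (simp add: infnorm_0)
  moreover have "continuous_on ?S (\<lambda>y. norm (transpose C *v (G - C *v y)))"
    by (intro continuous_on_norm linear_continuous_on_compose[OF _ matrix_vector_mul_linear]
        continuous_on_diff continuous_on_const continuous_on_id)
  ultimately obtain y where "y \<in> ?S"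
    "\<forall>z\<in>?S. norm (transpose C *v (G - C *v z)) \<le> norm (transpose C *v (G - C *v y))"
    using continuous_attains_sup[of ?S] by blast
  then have "is_arg_max (\<lambda>y. norm (transpose C *v (G - C *v y))) (\<lambda>y. infnorm y \<le> \<delta>) y"
    unfolding is_arg_max_linorder by blast
  then show ?thesis ..
qed

text \<open>
  The term \<open>norm1\<close> at the base point is bounded by \<open>\<theta>\<close>, and \<open>\<theta>\<close> at the linearized point by \<open>norm1\<close>
  plus \<open>2\<mu>\<close> per component; between the two, convexity of \<open>\<theta>\<close> gives its derivative. What remains is
  \<open>- \<nabla>\<Psi>(x) \<bullet> s\<close>.
\<close>

lemma linearized_decrease_le:
  fixes F :: "real ^ 'n \<Rightarrow> real ^ 'm" and C :: "real ^ 'r ^ 'm"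
  assumes deriv: "\<And>x. (F has_derivative (\<lambda>h. F' x *v h)) (at x)"
    and "0 < \<mu>" "0 \<le> \<delta>"
  shows "phi F F' C \<delta> x 0 - phi F F' C \<delta> x s
    \<le> norm (gradient (\<lambda>x. Psi F C \<delta> x \<mu>) x) * norm s + 4 * real CARD('r) * \<delta> * \<mu>"
proof -
  define t where "t = transpose C *v F x"
  define d where "d = transpose C *v (F' x *v s)"
  define w where "w i = t $ i / theta (t $ i) \<mu>" for i
  have "\<bar>t $ i\<bar> - \<bar>t $ i + d $ i\<bar> \<le> 2 * \<mu> - w i * d $ i" for i
    using theta_bounds[OF \<open>0 < \<mu>\<close>, of "t $ i"] theta_bounds[OF \<open>0 < \<mu>\<close>, of "t $ i + d $ i"]
      theta_convex_lower[OF \<open>0 < \<mu>\<close>, of "t $ i" "d $ i"]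
    unfolding w_def by linarith
  then have "(\<Sum>i\<in>UNIV. \<bar>t $ i\<bar> - \<bar>t $ i + d $ i\<bar>) \<le> (\<Sum>i\<in>UNIV. 2 * \<mu> - w i * d $ i)"
    by (rule sum_mono)
  then have "norm1 t - norm1 (t + d) \<le> 2 * real CARD('r) * \<mu> - (\<Sum>i\<in>UNIV. w i * d $ i)"
    by (simp add: norm1_def sum_subtractf mult_ac)
  from mult_left_mono[OF this, of "2 * \<delta>"]
  have "2 * \<delta> * norm1 t - 2 * \<delta> * norm1 (t + d)
      \<le> 4 * real CARD('r) * \<delta> * \<mu> - 2 * \<delta> * (\<Sum>i\<in>UNIV. w i * d $ i)"
    using \<open>0 \<le> \<delta>\<close> by (simp add: right_diff_distrib mult_ac)
  moreover have "phi F F' C \<delta> x 0 - phi F F' C \<delta> x s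
      = 2 * \<delta> * norm1 t - 2 * \<delta> * norm1 (t + d) - 2 * (F x \<bullet> (F' x *v s))"
    unfolding phi_def t_def d_def
    by (simp add: matrix_vector_right_distrib dot_lmul_matrix vector_matrix_left_distrib)
  moreover have "gradient (\<lambda>x. Psi F C \<delta> x \<mu>) x \<bullet> s
      = 2 * (F x \<bullet> (F' x *v s)) + 2 * \<delta> * (\<Sum>i\<in>UNIV. w i * d $ i)"
    by (simp only: gradient_Psi_inner[OF deriv \<open>0 < \<mu>\<close>] w_def t_def d_def)
  moreover have "- (gradient (\<lambda>x. Psi F C \<delta> x \<mu>) x \<bullet> s) \<le> norm (gradient (\<lambda>x. Psi F C \<delta> x \<mu>) x) * norm s"
    using Cauchy_Schwarz_ineq2[of "gradient (\<lambda>x. Psi F C \<delta> x \<mu>) x" s] by linarith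
  ultimately show ?thesis by linarith
qed

lemma eps_minimax_critical_of_small_gradient:
  fixes F :: "real ^ 'n \<Rightarrow> real ^ 'm" and C :: "real ^ 'r ^ 'm"
  assumes deriv: "\<And>x. (F has_derivative (\<lambda>h. F' x *v h)) (at x)"
    and "0 < \<epsilon>" "0 < \<delta>"
    and \<mu>: "\<mu> = \<epsilon> / (8 * real CARD('r) * \<delta>)"
    and small: "norm (gradient (\<lambda>x. Psi F C \<delta> x \<mu>) x) \<le> \<epsilon> / 2"
    and y: "is_arg_max (\<lambda>y. norm (transpose C *v (F x - C *v y))) (\<lambda>y. infnorm y \<le> \<delta>) y"
  shows "eps_minimax_critical F F' C \<delta> \<epsilon> x y"
proof -
  have "0 < \<mu>" and smoothing: "4 * real CARD('r) * \<delta> * \<mu> = \<epsilon> / 2"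
    using assms(2,3) by (auto simp: \<mu>)
  have "phi F F' C \<delta> x 0 - \<epsilon> \<le> (INF s\<in>cball 0 1. phi F F' C \<delta> x s)"
  proof (rule cINF_greatest)
    fix s :: "real ^ 'n" assume "s \<in> cball 0 1"
    then have "norm (gradient (\<lambda>x. Psi F C \<delta> x \<mu>) x) * norm s \<le> \<epsilon> / 2 * 1"
      using small \<open>0 < \<epsilon>\<close> by (intro mult_mono) auto
    then show "phi F F' C \<delta> x 0 - \<epsilon> \<le> phi F F' C \<delta> x s"
      using linearized_decrease_le[OF deriv \<open>0 < \<mu>\<close>, where \<delta> = \<delta> and C = C and x = x and s = s]
        \<open>0 < \<delta>\<close> smoothing by simp
  qed simp
  then show ?thesis
    using y by (simp add: eps_minimax_critical_def is_arg_max_def algebra_simps)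
qed

section \<open>Counting trials\<close>

text \<open>
  Here \<open>v\<close> stands for the function values and \<open>a\<close> for the step lengths or radii. The quantity
  \<open>k + ln (a k)/ln (1/\<beta>) + c v k/d\<close> with \<open>c = 1 + ln \<gamma>/ln (1/\<beta>)\<close> never increases: on rejection
  the second term pays for the trial, and on acceptance the third term pays for both the trial and the
  growth of \<open>a\<close>. The step hypothesis presupposes \<open>v k \<le> v 0\<close> and \<open>low \<le> a k\<close> because a
  trial is under control only in the initial sublevel set and above the lower bound; the induction
  carries both along.
\<close>

lemma trial_count_le:
  fixes a v :: "nat \<Rightarrow> real"
  assumes step: "\<And>k. k < N \<Longrightarrow> v k \<le> v 0 \<Longrightarrow> low \<le> a k \<Longrightarrow>
      low \<le> a (Suc k) \<and>
      (v (Suc k) \<le> v k - d \<and> a (Suc k) \<le> \<gamma> * a k \<or> v (Suc k) = v k \<and> a (Suc k) \<le> \<beta> * a k)"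
    and v_nonneg: "\<And>k. 0 \<le> v k"
    and start: "low \<le> a 0"
    and "0 < low" "0 < d" "0 < \<beta>" "\<beta> < 1" "1 \<le> \<gamma>"
  shows "real N \<le> a 0 / (ln (1 / \<beta>) * low) + (1 + ln \<gamma> / ln (1 / \<beta>)) * v 0 / d"
proof -
  let ?l = "ln (1 / \<beta>)"
  define c where "c = 1 + ln \<gamma> / ?l"
  have \<lambda>: "0 < ?l" and c: "1 \<le> c"
    using assms(6-8) by (auto simp: c_def)
  have inv: "v k \<le> v 0 \<and> low \<le> a k \<and> real k + ln (a k) / ?l + c * v k / d \<le> ln (a 0) / ?l + c * v 0 / d"
    if "k \<le> N" for k
    using that
  proof (induction k)
    case 0
    then show ?case using start by simp
  next
    case (Suc k)
    then have IH: "v k \<le> v 0" "low \<le> a k"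
      "real k + ln (a k) / ?l + c * v k / d \<le> ln (a 0) / ?l + c * v 0 / d"
      by simp_all
    have low: "low \<le> a (Suc k)" and cases:
      "v (Suc k) \<le> v k - d \<and> a (Suc k) \<le> \<gamma> * a k \<or> v (Suc k) = v k \<and> a (Suc k) \<le> \<beta> * a k"
      using step[of k] Suc.prems IH by auto
    have pos: "0 < a k" "0 < a (Suc k)"
      using IH low \<open>0 < low\<close> by linarith+
    from cases show ?case
    proof (elim disjE conjE)
      assume v: "v (Suc k) \<le> v k - d" and a: "a (Suc k) \<le> \<gamma> * a k"
      have "ln (a (Suc k)) \<le> ln \<gamma> + ln (a k)"
        using ln_mono[OF a pos(2)] ln_mult[of \<gamma> "a k"] pos \<open>1 \<le> \<gamma>\<close> by simp
      then have "ln (a (Suc k)) / ?l \<le> (ln \<gamma> + ln (a k)) / ?l"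
        using \<lambda> by (intro divide_right_mono) auto
      then have 1: "ln (a (Suc k)) / ?l \<le> c - 1 + ln (a k) / ?l"
        by (simp add: c_def add_divide_distrib)
      have "c * v (Suc k) / d \<le> c * (v k - d) / d"
        using v c \<open>0 < d\<close> by (intro divide_right_mono mult_left_mono) auto
      also have "\<dots> = c * v k / d - c"
        using \<open>0 < d\<close> by (simp add: field_simps)
      finally show ?thesis
        using 1 IH low v \<open>0 < d\<close> by simp
    next
      assume v: "v (Suc k) = v k" and a: "a (Suc k) \<le> \<beta> * a k"
      have "ln (a (Suc k)) \<le> ln \<beta> + ln (a k)"
        using ln_mono[OF a pos(2)] ln_mult[of \<beta> "a k"] pos \<open>0 < \<beta>\<close> by simp
      also have "ln \<beta> = - ?l"
        using \<open>0 < \<beta>\<close> by (simp add: ln_div)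
      finally have "ln (a (Suc k)) / ?l \<le> (ln (a k) - ?l) / ?l"
        using \<lambda> by (intro divide_right_mono) auto
      then have "ln (a (Suc k)) / ?l \<le> ln (a k) / ?l - 1"
        using \<lambda> by (simp add: diff_divide_distrib)
      then show ?thesis
        using IH low v by simp
    qed
  qed
  have end_inv: "low \<le> a N" "real N + ln (a N) / ?l + c * v N / d \<le> ln (a 0) / ?l + c * v 0 / d"
    using inv[of N] by auto
  have "ln (a 0) - ln (a N) \<le> ln (a 0 / low)"
    using end_inv start \<open>0 < low\<close> by (simp add: ln_div)
  also have "\<dots> \<le> a 0 / low"
    using ln_le_minus_one[of "a 0 / low"] start \<open>0 < low\<close> by simp
  finally have "(ln (a 0) - ln (a N)) / ?l \<le> a 0 / low / ?l"
    using \<lambda> by (intro divide_right_mono) auto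
  moreover have "0 \<le> c * v N / d"
    using c v_nonneg \<open>0 < d\<close> by (intro divide_nonneg_pos mult_nonneg_nonneg) auto
  ultimately show ?thesis
    using end_inv(2) by (simp add: c_def diff_divide_distrib mult.commute)
qed

text \<open>
  The inequality is confined to base points in a sublevel set and to steps of length at most 1; the end
  point \<open>x + s\<close> may leave the sublevel set, as a rejected trial point can. Nonnegativity is included
  so that \<open>V\<close> also bounds the total decrease available from the sublevel set.
\<close>

definition local_descent :: "(real ^ 'n \<Rightarrow> real) \<Rightarrow> real \<Rightarrow> real \<Rightarrow> bool" where
  "local_descent f V L \<longleftrightarrow>
     (\<forall>x. 0 \<le> f x) \<and>
     (\<forall>x s. f x \<le> V \<longrightarrow> norm s \<le> 1 \<longrightarrow> f (x + s) \<le> f x + gradient f x \<bullet> s + L * (norm s)\<^sup>2)"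

lemma local_descent_gradient_step:
  assumes "local_descent f V L" "f x \<le> V" "0 \<le> \<tau>" "\<tau> * norm (gradient f x) \<le> 1"
  shows "f (x - \<tau> *\<^sub>R gradient f x)
    \<le> f x - \<tau> * (norm (gradient f x))\<^sup>2 + L * \<tau>\<^sup>2 * (norm (gradient f x))\<^sup>2"
proof -
  let ?s = "- (\<tau> *\<^sub>R gradient f x)"
  have "f (x + ?s) \<le> f x + gradient f x \<bullet> ?s + L * (norm ?s)\<^sup>2"
    using assms unfolding local_descent_def by (metis abs_of_nonneg norm_minus_cancel norm_scaleR)
  then show ?thesis
    by (simp add: power_mult_distrib dot_square_norm mult.assoc)
qed

text \<open>
  A unit step against a larger gradient would make \<open>f\<close> negative. The bound turns a short step length
  into a short step, as the linesearch needs to stay within the unit ball of the descent inequality.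
\<close>

lemma local_descent_gradient_le:
  assumes "local_descent f V L" "f x \<le> V" "0 \<le> L"
  shows "norm (gradient f x) \<le> V + L"
proof -
  let ?g = "gradient f x"
  have nonneg: "0 \<le> f y" for y
    using assms(1) by (simp add: local_descent_def)
  show ?thesis
  proof (cases "?g = 0")
    case True
    then show ?thesis
      using nonneg[of x] assms(2,3) by simp
  next
    case False
    have "f (x - (1 / norm ?g) *\<^sub>R ?g) \<le> f x - norm ?g + L"
      using local_descent_gradient_step[OF assms(1,2), of "1 / norm ?g"] False
      by (simp add: power2_eq_square)
    then show ?thesis
      using nonneg[of "x - (1 / norm ?g) *\<^sub>R ?g"] assms(2) by linarith
  qed
qed

text \<open>
  The two safeguards differ in what \<open>a\<close> and its lower bound mean. What they share is the
  \<open>step\<close> hypothesis, which yields termination and the bound together: a run that had not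
  stopped after more trials than the bound would contradict \<open>trial_count_le\<close>.

  The logarithm of \<open>a 0/low\<close> has already been replaced by \<open>a 0/low\<close> itself. This is affordable, as
  \<open>1/low\<close> is at most a multiple of \<open>L/tol\<close>, hence of \<open>L/tol\<^sup>2\<close>.
\<close>

lemma stops_within:
  assumes descent: "local_descent f V L" and start: "f (x 0) \<le> V"
    and tol: "0 < tol" "tol \<le> 1" and L: "1 \<le> L"
    and "0 < \<sigma>" "0 < \<omega>" "0 < \<beta>" "\<beta> < 1" "1 \<le> \<gamma>"
    and low: "\<sigma> * tol / L \<le> low" "low \<le> a 0"
    and step: "\<And>k. tol < norm (gradient f (x k)) \<Longrightarrow> f (x k) \<le> V \<Longrightarrow> low \<le> a k \<Longrightarrow>
      low \<le> a (Suc k) \<and>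
      (f (x (Suc k)) \<le> f (x k) - \<omega> * tol\<^sup>2 / L \<and> a (Suc k) \<le> \<gamma> * a k
        \<or> f (x (Suc k)) = f (x k) \<and> a (Suc k) \<le> \<beta> * a k)"
  shows "\<exists>k. stops_at f tol x k \<and>
    real k \<le> (a 0 / (ln (1 / \<beta>) * \<sigma>) + (1 + ln \<gamma> / ln (1 / \<beta>)) * V / \<omega>) * L / tol\<^sup>2"
proof -
  let ?l = "ln (1 / \<beta>)"
  let ?bound = "(a 0 / (?l * \<sigma>) + (1 + ln \<gamma> / ?l) * V / \<omega>) * L / tol\<^sup>2"
  have l: "0 < ?l"
    using assms by simp
  have base: "0 < \<sigma> * tol / L"
    using assms by simp
  then have "0 < low"
    using low by linarith
  have count: "real N \<le> ?bound" if large: "\<And>k. k < N \<Longrightarrow> tol < norm (gradient f (x k))" for N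
  proof -
    have "real N \<le> a 0 / (?l * low) + (1 + ln \<gamma> / ?l) * f (x 0) / (\<omega> * tol\<^sup>2 / L)"
    proof (rule trial_count_le[where v = "\<lambda>k. f (x k)" and a = a and \<beta> = \<beta> and \<gamma> = \<gamma>])
      show "0 \<le> f (x k)" for k
        using descent by (simp add: local_descent_def)
    qed (use assms \<open>0 < low\<close> step large in auto)
    also have "a 0 / (?l * low) \<le> a 0 / (?l * (\<sigma> * tol / L))"
      using low l base \<open>0 < low\<close>
      by (intro divide_left_mono mult_left_mono mult_pos_pos) auto
    also have "\<dots> = a 0 / (?l * \<sigma>) * L / tol"
      by simp
    also have "\<dots> \<le> a 0 / (?l * \<sigma>) * L / tol\<^sup>2"
    proof (rule divide_left_mono)
      show "tol\<^sup>2 \<le> tol"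
        using tol by (simp add: power2_eq_square mult_left_le)
      show "0 \<le> a 0 / (?l * \<sigma>) * L"
        using low l base L \<open>0 < \<sigma>\<close> by simp
    qed (use tol in simp)
    also have "(1 + ln \<gamma> / ?l) * f (x 0) / (\<omega> * tol\<^sup>2 / L) \<le> (1 + ln \<gamma> / ?l) * V / (\<omega> * tol\<^sup>2 / L)"
      using start l assms by (intro divide_right_mono mult_left_mono) auto
    also have "\<dots> = (1 + ln \<gamma> / ?l) * V / \<omega> * L / tol\<^sup>2"
      by simp
    finally show ?thesis
      by (simp add: distrib_right add_divide_distrib)
  qed
  have "\<exists>k. norm (gradient f (x k)) \<le> tol"
  proof (rule ccontr)
    assume "\<not> ?thesis"
    then have "real N \<le> ?bound" for N
      by (intro count) (simp add: not_le)
    then show False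
      by (meson linorder_not_le reals_Archimedean2)
  qed
  then obtain k where k: "norm (gradient f (x k)) \<le> tol" "\<And>j. j < k \<Longrightarrow> tol < norm (gradient f (x j))"
    using exists_least_iff[of "\<lambda>k. norm (gradient f (x k)) \<le> tol"] by (auto simp: not_le)
  then show ?thesis
    using count[of k] by (intro exI[of _ k]) (simp add: stops_at_def)
qed

section \<open>Linesearch\<close>

text \<open>
  A rejection forces \<open>a > (1 - c)/((1 + V) L)\<close>. Otherwise \<open>a \<le> (1 - c)/(V + L)\<close>, so the trial step has
  length at most 1 and the descent inequality with \<open>a L \<le> 1 - c\<close> yields the Armijo condition. Hence
  backtracking by at least \<open>\<beta>1\<close> keeps \<open>a\<close> above the bound.
\<close>

lemma linesearch_trial_step:
  assumes descent: "local_descent f V L" and fx: "f x \<le> V"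
    and L: "1 \<le> L" and V: "0 \<le> V" and tol: "0 < tol" "tol < norm g"
    and g: "g = gradient f x"
    and par: "0 < c" "c < 1" "0 < \<beta>1"
    and \<sigma>: "0 < \<sigma>" "\<sigma> \<le> \<beta>1 * (1 - c) / (1 + V)"
    and a: "\<sigma> / L \<le> a"
    and rule: "if f (x - a *\<^sub>R g) \<le> f x - c * a * (norm g)\<^sup>2
           then t = a \<and> a \<le> a' \<and> a' \<le> \<gamma> * a
           else t = 0 \<and> \<beta>1 * a \<le> a' \<and> a' \<le> \<beta>2 * a"
  shows "\<sigma> / L \<le> a' \<and>
      (f (x - t *\<^sub>R g) \<le> f x - c * \<sigma> * tol\<^sup>2 / L \<and> a' \<le> \<gamma> * a
        \<or> f (x - t *\<^sub>R g) = f x \<and> a' \<le> \<beta>2 * a)"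
proof (cases "f (x - a *\<^sub>R g) \<le> f x - c * a * (norm g)\<^sup>2")
  case True
  have "c * (\<sigma> / L) * tol\<^sup>2 \<le> c * a * (norm g)\<^sup>2"
    using par \<sigma> a tol L order_trans[OF _ a, of 0] by (intro mult_mono power_mono) auto
  with True rule a show ?thesis
    by simp
next
  case False
  have "(1 - c) / ((1 + V) * L) < a"
  proof (rule ccontr)
    assume "\<not> ?thesis"
    then have small: "a * ((1 + V) * L) \<le> 1 - c"
      using L V pos_le_divide_eq[of "(1 + V) * L" a "1 - c"] by (simp add: not_less)
    have "0 < a"
      using a \<sigma> L by (meson divide_pos_pos less_le_trans zero_less_one)
    have "V * 1 \<le> V * L"
      using L V by (intro mult_left_mono) auto
    then have "V + L \<le> (1 + V) * L" "L \<le> (1 + V) * L"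
      using V by (simp_all add: distrib_right)
    then have "a * (V + L) \<le> 1 - c" "a * L \<le> 1 - c"
      using small mult_left_mono[of "V + L" "(1 + V) * L" a] mult_left_mono[of L "(1 + V) * L" a] \<open>0 < a\<close>
      by linarith+
    moreover have "a * norm g \<le> a * (V + L)"
      using local_descent_gradient_le[OF descent fx] g L \<open>0 < a\<close> by simp
    ultimately have "a * norm g \<le> 1"
      using par by linarith
    then have "f (x - a *\<^sub>R g) \<le> f x - a * (norm g)\<^sup>2 + L * a\<^sup>2 * (norm g)\<^sup>2"
      unfolding g using \<open>0 < a\<close> par g
      by (intro local_descent_gradient_step[OF descent fx]) auto
    also have "\<dots> = f x - a * (norm g)\<^sup>2 + (a * L) * (a * (norm g)\<^sup>2)"
      by (simp add: power2_eq_square)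
    also have "\<dots> \<le> f x - a * (norm g)\<^sup>2 + (1 - c) * (a * (norm g)\<^sup>2)"
      using \<open>a * L \<le> 1 - c\<close> \<open>0 < a\<close> by (intro add_left_mono mult_right_mono) auto
    finally show False
      using False by (simp add: algebra_simps)
  qed
  then have "\<beta>1 * ((1 - c) / ((1 + V) * L)) \<le> \<beta>1 * a"
    using par by (intro mult_left_mono) auto
  moreover have "\<sigma> / L \<le> \<beta>1 * (1 - c) / (1 + V) / L"
    using \<sigma> L by (intro divide_right_mono) auto
  ultimately show ?thesis
    using False rule by simp
qed

section \<open>Trust region\<close>

text \<open>
  The step is compared with the multiple \<open>min (r/\<parallel>g\<parallel>) (1/(1 + \<kappa>))\<close> of the gradient, for which the
  quadratic term consumes at most half of the linear decrease. Using \<open>1 + \<kappa>\<close> in place of \<open>\<kappa>\<close> covers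
  the linear model.
\<close>

lemma cauchy_step_decrease:
  fixes g :: "real ^ 'n" and H :: "real ^ 'n ^ 'n"
  assumes "g \<noteq> 0" and H: "norm (H *v g) \<le> \<kappa> * norm g" and "0 \<le> \<kappa>" "0 < r"
    and \<tau>: "is_arg_max (\<lambda>\<tau>. \<tau> * (norm g)\<^sup>2 - \<tau>\<^sup>2 / 2 * (g \<bullet> (H *v g))) (\<lambda>\<tau>. 0 \<le> \<tau> \<and> norm (\<tau> *\<^sub>R g) \<le> r) \<tau>"
  shows "norm g * min r (norm g / (1 + \<kappa>)) / 2 \<le> \<tau> * (norm g)\<^sup>2 - \<tau>\<^sup>2 / 2 * (g \<bullet> (H *v g))"
proof -
  define \<sigma> where "\<sigma> = min (r / norm g) (1 / (1 + \<kappa>))"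
  have \<sigma>: "0 \<le> \<sigma>" "\<sigma> * norm g \<le> r" "\<sigma> * (1 + \<kappa>) \<le> 1"
    using assms by (auto simp: \<sigma>_def min_def field_simps)
  have "\<bar>g \<bullet> (H *v g)\<bar> \<le> norm g * (\<kappa> * norm g)"
    by (rule order_trans[OF Cauchy_Schwarz_ineq2 mult_left_mono[OF H]]) simp
  then have gHg: "g \<bullet> (H *v g) \<le> (1 + \<kappa>) * (norm g)\<^sup>2"
    by (simp add: power2_eq_square algebra_simps) (smt (verit) zero_le_square)
  have "norm g * min r (norm g / (1 + \<kappa>)) / 2 = \<sigma> * (norm g)\<^sup>2 / 2"
    using assms by (auto simp: \<sigma>_def min_def power2_eq_square field_simps)
  also have "\<dots> \<le> \<sigma> * (norm g)\<^sup>2 - \<sigma>\<^sup>2 / 2 * (g \<bullet> (H *v g))"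
  proof -
    have "\<sigma>\<^sup>2 / 2 * (g \<bullet> (H *v g)) \<le> \<sigma>\<^sup>2 / 2 * ((1 + \<kappa>) * (norm g)\<^sup>2)"
      by (rule mult_left_mono[OF gHg]) simp
    also have "\<dots> = (\<sigma> * (1 + \<kappa>)) * (\<sigma> * (norm g)\<^sup>2 / 2)"
      by (simp add: power2_eq_square)
    also have "\<dots> \<le> 1 * (\<sigma> * (norm g)\<^sup>2 / 2)"
      using \<sigma> by (intro mult_right_mono) auto
    finally show ?thesis by simp
  qed
  also have "\<dots> \<le> \<tau> * (norm g)\<^sup>2 - \<tau>\<^sup>2 / 2 * (g \<bullet> (H *v g))"
    using \<tau> \<sigma> by (auto simp: is_arg_max_linorder)
  finally show ?thesis .
qed

text \<open>
  The model and the function differ from above by at most \<open>(L + \<kappa>/2) \<parallel>step\<parallel>\<^sup>2\<close>, of order \<open>r\<^sup>2\<close>, while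
  the predicted decrease is at least \<open>\<parallel>g\<parallel> r/2\<close> for small \<open>r\<close>. So a radius of at most the threshold \<open>m\<close>,
  of order \<open>tol/L\<close>, makes the trial very successful, and the radius is reduced only above \<open>m\<close>.
\<close>

lemma trust_region_trial_step:
  fixes f :: "real ^ 'n \<Rightarrow> real" and H :: "real ^ 'n ^ 'n"
  assumes descent: "local_descent f V L" and fx: "f x \<le> V"
    and L: "1 \<le> L" and tol: "0 < tol" "tol \<le> 1" "tol < norm g"
    and g: "g = gradient f x"
    and par: "0 < \<eta>1" "\<eta>1 \<le> \<eta>2" "\<eta>2 < 1" "0 < \<gamma>1" "\<gamma>1 \<le> \<gamma>2" "\<gamma>2 < 1" "1 \<le> \<gamma>3" "0 \<le> \<kappa>"
    and \<sigma>: "0 < \<sigma>" "\<sigma> \<le> \<gamma>1 * (1 - \<eta>2) / (2 * (2 + \<kappa>))"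
    and r: "\<sigma> * tol / L \<le> r"
    and H: "onorm ((*v) H) \<le> \<kappa>"
    and pred: "pred = (\<lambda>\<tau>. \<tau> * (norm g)\<^sup>2 - \<tau>\<^sup>2 / 2 * (g \<bullet> (H *v g)))"
    and \<tau>: "is_arg_max pred (\<lambda>\<tau>. 0 \<le> \<tau> \<and> norm (\<tau> *\<^sub>R g) \<le> r) \<tau>"
    and \<rho>: "\<rho> = (f x - f (x - \<tau> *\<^sub>R g)) / pred \<tau>"
    and t: "t = (if \<eta>1 \<le> \<rho> then \<tau> else 0)"
    and rule: "if \<eta>2 \<le> \<rho> then r \<le> r' \<and> r' \<le> \<gamma>3 * r
                else if \<eta>1 \<le> \<rho> then \<gamma>2 * r \<le> r' \<and> r' \<le> r
                else \<gamma>1 * r \<le> r' \<and> r' \<le> \<gamma>2 * r"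
  shows "\<sigma> * tol / L \<le> r' \<and>
      (f (x - t *\<^sub>R g) \<le> f x - \<eta>1 * \<sigma> / 2 * tol\<^sup>2 / L \<and> r' \<le> \<gamma>3 * r
        \<or> f (x - t *\<^sub>R g) = f x \<and> r' \<le> \<gamma>2 * r)"
proof -
  \<comment> \<open>solves \<open>(2 + \<kappa>) L m = (1 - \<eta>2) tol/2\<close>, where model error meets tolerated shortfall\<close>
  define m where "m = (1 - \<eta>2) / (2 * (2 + \<kappa>)) * tol / L"
  have "g \<noteq> 0" "0 < norm g"
    using tol by auto
  have "0 < \<sigma> * tol / L"
    using \<sigma> tol L by simp
  then have "0 < r"
    using r by linarith
  have \<tau>': "0 \<le> \<tau>" "\<tau> * norm g \<le> r"
    using \<tau> by (auto simp: is_arg_max_def)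
  have Hg: "norm (H *v g) \<le> \<kappa> * norm g"
    using order_trans[OF onorm[OF matrix_vector_mul_bounded_linear] mult_right_mono[OF H]] by simp
  have gHg: "\<bar>g \<bullet> (H *v g)\<bar> \<le> \<kappa> * (norm g)\<^sup>2"
    using order_trans[OF Cauchy_Schwarz_ineq2 mult_left_mono[OF Hg]]
    by (simp add: power2_eq_square mult_ac)
  have pred_ge: "norm g * min r (norm g / (1 + \<kappa>)) / 2 \<le> pred \<tau>"
    using cauchy_step_decrease[OF \<open>g \<noteq> 0\<close> Hg _ \<open>0 < r\<close> \<tau>[unfolded pred]] par by (simp add: pred)
  have pred_pos: "0 < pred \<tau>"
    using pred_ge \<open>0 < r\<close> \<open>0 < norm g\<close> par
    by (smt (verit, ccfv_threshold) divide_pos_pos min_less_iff_conj mult_pos_pos)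
  have \<sigma>m: "\<sigma> * tol / L \<le> \<gamma>1 * m"
  proof -
    have "\<sigma> * (tol / L) \<le> \<gamma>1 * (1 - \<eta>2) / (2 * (2 + \<kappa>)) * (tol / L)"
      using \<sigma> tol L by (intro mult_right_mono) auto
    then show ?thesis by (simp add: m_def)
  qed
  have m_tol: "m \<le> tol / (1 + \<kappa>)" "m \<le> 1"
  proof -
    have "(1 - \<eta>2) / (2 * (2 + \<kappa>)) \<le> 1 / (1 + \<kappa>)"
      using par by (intro frac_le) auto
    then have "(1 - \<eta>2) / (2 * (2 + \<kappa>)) * tol / L \<le> 1 / (1 + \<kappa>) * tol / 1"
      using tol L par by (intro frac_le mult_right_mono) auto
    then show "m \<le> tol / (1 + \<kappa>)"
      by (simp add: m_def)
    also have "\<dots> \<le> 1"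
      using tol par by simp
    finally show "m \<le> 1" .
  qed
  have very_successful: "\<eta>2 \<le> \<rho>" if "r \<le> m"
  proof -
    have small: "r \<le> norm g / (1 + \<kappa>)"
    proof -
      have "tol / (1 + \<kappa>) \<le> norm g / (1 + \<kappa>)"
        using tol par by (intro divide_right_mono) auto
      then show ?thesis using that m_tol by linarith
    qed
    have "f (x - \<tau> *\<^sub>R g) \<le> f x - \<tau> * (norm g)\<^sup>2 + L * \<tau>\<^sup>2 * (norm g)\<^sup>2"
      unfolding g using \<tau>' that m_tol g
      by (intro local_descent_gradient_step[OF descent fx]) auto
    also have "\<dots> \<le> f x - pred \<tau> + (L + \<kappa> / 2) * (\<tau> * norm g)\<^sup>2"
    proof -
      have "\<tau>\<^sup>2 / 2 * (- (g \<bullet> (H *v g))) \<le> \<tau>\<^sup>2 / 2 * (\<kappa> * (norm g)\<^sup>2)"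
        using gHg by (intro mult_left_mono) auto
      then show ?thesis
        by (simp add: pred power_mult_distrib algebra_simps)
    qed
    also have "(L + \<kappa> / 2) * (\<tau> * norm g)\<^sup>2 \<le> ((2 + \<kappa>) * L) * (r * r)"
    proof (rule mult_mono)
      have "\<kappa> * 1 \<le> \<kappa> * L"
        using L par by (intro mult_left_mono) auto
      then show "L + \<kappa> / 2 \<le> (2 + \<kappa>) * L"
        using L par by (simp add: distrib_right)
      show "(\<tau> * norm g)\<^sup>2 \<le> r * r"
        using power_mono[OF \<tau>'(2), of 2] \<tau>' by (simp add: power2_eq_square)
    qed (use L par in auto)
    also have "\<dots> \<le> (1 - \<eta>2) * pred \<tau>"
    proof -
      have mL: "m * ((2 + \<kappa>) * L) = (1 - \<eta>2) * (tol / 2)"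
      proof -
        have "(1 - \<eta>2) / (2 * q) * tol / L * (q * L) = (1 - \<eta>2) * (tol / 2)" if "q \<noteq> 0" for q
          using that L by simp
        from this[of "2 + \<kappa>"] show ?thesis
          using par by (simp add: m_def del: distrib_left_numeral)
      qed
      have "((2 + \<kappa>) * L) * (r * r) \<le> ((2 + \<kappa>) * L) * (m * r)"
        using that \<open>0 < r\<close> L par by (intro mult_left_mono mult_right_mono) auto
      also have "\<dots> = (1 - \<eta>2) * (tol * r / 2)"
        using arg_cong[OF mL, of "\<lambda>z. z * r"] by (simp add: mult_ac)
      also have "\<dots> \<le> (1 - \<eta>2) * (norm g * r / 2)"
        using tol par \<open>0 < r\<close> by (intro mult_left_mono divide_right_mono mult_right_mono) auto
      also have "\<dots> \<le> (1 - \<eta>2) * pred \<tau>"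
        using pred_ge small par by (intro mult_left_mono) (auto simp: min_def split: if_splits)
      finally show ?thesis .
    qed
    finally have "\<eta>2 * pred \<tau> \<le> f x - f (x - \<tau> *\<^sub>R g)"
      by (simp add: algebra_simps)
    then show ?thesis
      using pred_pos by (simp add: \<rho> pos_le_divide_eq)
  qed
  have m_pos: "0 < m"
    using par tol L by (simp add: m_def)
  have lower: "\<sigma> * tol / L \<le> r'"
  proof (cases "\<eta>2 \<le> \<rho>")
    case True
    then show ?thesis using rule r by simp
  next
    case False
    then have "m < r"
      using very_successful by linarith
    then have "\<gamma>1 * m \<le> \<gamma>1 * r" "\<gamma>1 * r \<le> \<gamma>2 * r"
      using par m_pos by (auto intro: mult_mono)
    then show ?thesis
      using False rule \<sigma>m by (auto split: if_splits)
  qed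
  show ?thesis
  proof (cases "\<eta>1 \<le> \<rho>")
    case True
    have "\<sigma> * tol / L \<le> norm g / (1 + \<kappa>)"
    proof -
      have "\<gamma>1 * m \<le> 1 * m"
        using par m_pos by (intro mult_right_mono) auto
      moreover have "tol / (1 + \<kappa>) \<le> norm g / (1 + \<kappa>)"
        using tol par by (intro divide_right_mono) auto
      ultimately show ?thesis
        using \<sigma>m m_tol by linarith
    qed
    then have "tol * (\<sigma> * tol / L) / 2 \<le> norm g * min r (norm g / (1 + \<kappa>)) / 2"
      using r tol \<open>0 < \<sigma> * tol / L\<close> by (intro divide_right_mono mult_mono) auto
    then have "\<eta>1 * (tol * (\<sigma> * tol / L) / 2) \<le> \<eta>1 * pred \<tau>"
      using par by (intro mult_left_mono order_trans[OF _ pred_ge]) auto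
    also have "\<dots> \<le> f x - f (x - \<tau> *\<^sub>R g)"
      using True pred_pos by (simp add: \<rho> pos_le_divide_eq)
    finally have "f (x - t *\<^sub>R g) \<le> f x - \<eta>1 * \<sigma> / 2 * tol\<^sup>2 / L"
      using True by (simp add: t power2_eq_square mult_ac)
    moreover have "r' \<le> \<gamma>3 * r"
    proof -
      have "r' \<le> \<gamma>3 * r \<or> r' \<le> r"
        using rule True by (auto split: if_splits)
      moreover have "1 * r \<le> \<gamma>3 * r"
        using \<open>1 \<le> \<gamma>3\<close> \<open>0 < r\<close> by (intro mult_right_mono) auto
      ultimately show ?thesis by linarith
    qed
    ultimately show ?thesis
      using lower by simp
  next
    case False
    then show ?thesis
      using lower rule par by (simp add: t)
  qed
qed

section \<open>Evaluation complexity of steepest descent\<close>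

lemma evaluations_le: "evaluations t k \<le> 2 + 2 * k"
  by (induction k) auto

text \<open>
  The constant is chosen before \<open>f\<close>, \<open>L\<close> and \<open>tol\<close>: it depends only on the safeguard and on \<open>V\<close>, so
  the same one serves the smoothed objectives for all smoothing parameters.
\<close>

theorem steepest_descent_complexity:
  fixes V :: real
  assumes "admissible S" "0 \<le> V"
  shows "\<exists>K>0. \<forall>(f :: real ^ 'n \<Rightarrow> real) L tol x0 x t.
    local_descent f V L \<longrightarrow> 1 \<le> L \<longrightarrow> 0 < tol \<longrightarrow> tol \<le> 1 \<longrightarrow> f x0 \<le> V \<longrightarrow>
    steepest_descent_run S f tol x0 x t \<longrightarrow>
    (\<exists>k. stops_at f tol x k \<and> real (evaluations t k) \<le> K * L / tol\<^sup>2)"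
proof -
  have "\<exists>K\<ge>0. \<forall>(f :: real ^ 'n \<Rightarrow> real) L tol x0 x t.
    local_descent f V L \<longrightarrow> 1 \<le> L \<longrightarrow> 0 < tol \<longrightarrow> tol \<le> 1 \<longrightarrow> f x0 \<le> V \<longrightarrow>
    steepest_descent_run S f tol x0 x t \<longrightarrow>
    (\<exists>k. stops_at f tol x k \<and> real k \<le> K * L / tol\<^sup>2)"
  proof (cases S)
    case (Linesearch c \<beta>1 \<beta>2 \<gamma> \<alpha>0)
    then have par: "0 < c" "c < 1" "0 < \<beta>1" "\<beta>1 \<le> \<beta>2" "\<beta>2 < 1" "1 \<le> \<gamma>" "0 < \<alpha>0"
      using assms by auto
    define \<sigma> where "\<sigma> = min \<alpha>0 (\<beta>1 * (1 - c) / (1 + V))"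
    have \<sigma>: "0 < \<sigma>" "\<sigma> \<le> \<alpha>0" "\<sigma> \<le> \<beta>1 * (1 - c) / (1 + V)"
      using par assms by (auto simp: \<sigma>_def)
    show ?thesis
    proof (intro exI[of _ "\<alpha>0 / (ln (1 / \<beta>2) * \<sigma>) + (1 + ln \<gamma> / ln (1 / \<beta>2)) * V / (c * \<sigma>)"] conjI allI impI)
      show "0 \<le> \<alpha>0 / (ln (1 / \<beta>2) * \<sigma>) + (1 + ln \<gamma> / ln (1 / \<beta>2)) * V / (c * \<sigma>)"
        using par \<sigma> assms by simp
      fix f :: "real ^ 'n \<Rightarrow> real" and L tol x0 x t
      assume f: "local_descent f V L" "1 \<le> L" "0 < tol" "tol \<le> 1" "f x0 \<le> V"
        and run: "steepest_descent_run S f tol x0 x t"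
      obtain a where a: "a 0 = \<alpha>0"
        and rule: "\<And>k. tol < norm (gradient f (x k)) \<Longrightarrow>
          if f (x k - a k *\<^sub>R gradient f (x k)) \<le> f (x k) - c * a k * (norm (gradient f (x k)))\<^sup>2
           then t k = a k \<and> a k \<le> a (Suc k) \<and> a (Suc k) \<le> \<gamma> * a k
           else t k = 0 \<and> \<beta>1 * a k \<le> a (Suc k) \<and> a (Suc k) \<le> \<beta>2 * a k"
        using run unfolding Linesearch steepest_descent_run_def safeguarded.simps linesearch_steps_def Let_def
        by blast
      have x: "x 0 = x0" "\<And>k. x (Suc k) = x k - t k *\<^sub>R gradient f (x k)"
        using run by (auto simp: steepest_descent_run_def)
      have "\<exists>k. stops_at f tol x k \<and>
        real k \<le> (a 0 / (ln (1 / \<beta>2) * \<sigma>) + (1 + ln \<gamma> / ln (1 / \<beta>2)) * V / (c * \<sigma>)) * L / tol\<^sup>2"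
      proof (rule stops_within[where low = "\<sigma> / L"])
        show "\<sigma> * tol / L \<le> \<sigma> / L"
          using f \<sigma> by (intro divide_right_mono) auto
        show "\<sigma> / L \<le> a 0"
          using f \<sigma> a by (smt (verit, best) divide_le_eq_1 frac_le divide_self_if div_by_1)
        show "\<sigma> / L \<le> a (Suc k) \<and>
            (f (x (Suc k)) \<le> f (x k) - c * \<sigma> * tol\<^sup>2 / L \<and> a (Suc k) \<le> \<gamma> * a k
              \<or> f (x (Suc k)) = f (x k) \<and> a (Suc k) \<le> \<beta>2 * a k)"
          if "tol < norm (gradient f (x k))" "f (x k) \<le> V" "\<sigma> / L \<le> a k" for k
          unfolding x(2)
          by (rule linesearch_trial_step[OF f(1) that(2) f(2) assms(2) f(3) that(1) refl par(1-3) \<sigma>(1,3) that(3)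
                rule[OF that(1)]])
      qed (use f par \<sigma> x in auto)
      then show "\<exists>k. stops_at f tol x k \<and>
        real k \<le> (\<alpha>0 / (ln (1 / \<beta>2) * \<sigma>) + (1 + ln \<gamma> / ln (1 / \<beta>2)) * V / (c * \<sigma>)) * L / tol\<^sup>2"
        unfolding a .
    qed
  next
    case (TrustRegion \<eta>1 \<eta>2 \<gamma>1 \<gamma>2 \<gamma>3 \<kappa> \<Delta>0)
    then have par: "0 < \<eta>1" "\<eta>1 \<le> \<eta>2" "\<eta>2 < 1" "0 < \<gamma>1" "\<gamma>1 \<le> \<gamma>2" "\<gamma>2 < 1" "1 \<le> \<gamma>3" "0 \<le> \<kappa>" "0 < \<Delta>0"
      using assms by auto
    define \<sigma> where "\<sigma> = min \<Delta>0 (\<gamma>1 * (1 - \<eta>2) / (2 * (2 + \<kappa>)))"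
    have \<sigma>: "0 < \<sigma>" "\<sigma> \<le> \<Delta>0" "\<sigma> \<le> \<gamma>1 * (1 - \<eta>2) / (2 * (2 + \<kappa>))"
      using par assms by (auto simp: \<sigma>_def)
    show ?thesis
    proof (intro exI[of _ "\<Delta>0 / (ln (1 / \<gamma>2) * \<sigma>) + (1 + ln \<gamma>3 / ln (1 / \<gamma>2)) * V / (\<eta>1 * \<sigma> / 2)"] conjI allI impI)
      show "0 \<le> \<Delta>0 / (ln (1 / \<gamma>2) * \<sigma>) + (1 + ln \<gamma>3 / ln (1 / \<gamma>2)) * V / (\<eta>1 * \<sigma> / 2)"
        using par \<sigma> assms by simp
      fix f :: "real ^ 'n \<Rightarrow> real" and L tol x0 x t
      assume f: "local_descent f V L" "1 \<le> L" "0 < tol" "tol \<le> 1" "f x0 \<le> V"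
        and run: "steepest_descent_run S f tol x0 x t"
      obtain \<Delta> :: "nat \<Rightarrow> real" and H :: "nat \<Rightarrow> real ^ 'n ^ 'n" and \<tau> :: "nat \<Rightarrow> real"
        where \<Delta>: "\<Delta> 0 = \<Delta>0"
        and rule: "\<forall>k. let g = gradient f (x k);
                pred = (\<lambda>\<tau>. \<tau> * (norm g)\<^sup>2 - \<tau>\<^sup>2 / 2 * (g \<bullet> (H k *v g)));
                \<rho> = (f (x k) - f (x k - \<tau> k *\<^sub>R g)) / pred (\<tau> k)
            in tol < norm g \<longrightarrow>
               transpose (H k) = H k \<and> onorm ((*v) (H k)) \<le> \<kappa> \<and>
               is_arg_max pred (\<lambda>\<tau>. 0 \<le> \<tau> \<and> norm (\<tau> *\<^sub>R g) \<le> \<Delta> k) (\<tau> k) \<and>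
               t k = (if \<eta>1 \<le> \<rho> then \<tau> k else 0) \<and>
               (if \<eta>2 \<le> \<rho> then \<Delta> k \<le> \<Delta> (Suc k) \<and> \<Delta> (Suc k) \<le> \<gamma>3 * \<Delta> k
                else if \<eta>1 \<le> \<rho> then \<gamma>2 * \<Delta> k \<le> \<Delta> (Suc k) \<and> \<Delta> (Suc k) \<le> \<Delta> k
                else \<gamma>1 * \<Delta> k \<le> \<Delta> (Suc k) \<and> \<Delta> (Suc k) \<le> \<gamma>2 * \<Delta> k)"
        using run unfolding TrustRegion steepest_descent_run_def safeguarded.simps trust_region_steps_def
        by blast
      have x: "x 0 = x0" "\<And>k. x (Suc k) = x k - t k *\<^sub>R gradient f (x k)"
        using run by (auto simp: steepest_descent_run_def)
      have "\<exists>k. stops_at f tol x k \<and>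
        real k \<le> (\<Delta> 0 / (ln (1 / \<gamma>2) * \<sigma>) + (1 + ln \<gamma>3 / ln (1 / \<gamma>2)) * V / (\<eta>1 * \<sigma> / 2)) * L / tol\<^sup>2"
      proof (rule stops_within[where low = "\<sigma> * tol / L"])
        have "\<sigma> * tol / L \<le> \<sigma> * 1 / 1"
          using f \<sigma> by (intro frac_le mult_left_mono) auto
        then show "\<sigma> * tol / L \<le> \<Delta> 0"
          using \<sigma> \<Delta> by simp
        show "\<sigma> * tol / L \<le> \<Delta> (Suc k) \<and>
            (f (x (Suc k)) \<le> f (x k) - \<eta>1 * \<sigma> / 2 * tol\<^sup>2 / L \<and> \<Delta> (Suc k) \<le> \<gamma>3 * \<Delta> k
              \<or> f (x (Suc k)) = f (x k) \<and> \<Delta> (Suc k) \<le> \<gamma>2 * \<Delta> k)"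
          if "tol < norm (gradient f (x k))" "f (x k) \<le> V" "\<sigma> * tol / L \<le> \<Delta> k" for k
        proof -
          note rule_k = rule[unfolded Let_def, rule_format, OF that(1)]
          show ?thesis
            unfolding x(2)
            using trust_region_trial_step[OF f(1) that(2) f(2,3,4) that(1) refl par(1-8) \<sigma>(1,3) that(3) _ refl _ refl]
              rule_k by blast
        qed
      qed (use f par \<sigma> x in auto)
      then show "\<exists>k. stops_at f tol x k \<and>
        real k \<le> (\<Delta>0 / (ln (1 / \<gamma>2) * \<sigma>) + (1 + ln \<gamma>3 / ln (1 / \<gamma>2)) * V / (\<eta>1 * \<sigma> / 2)) * L / tol\<^sup>2"
        unfolding \<Delta> .
    qed
  qed
  then obtain K where "0 \<le> K"
    and K: "\<And>(f :: real ^ 'n \<Rightarrow> real) L tol x0 x t.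
      \<lbrakk>local_descent f V L; 1 \<le> L; 0 < tol; tol \<le> 1; f x0 \<le> V; steepest_descent_run S f tol x0 x t\<rbrakk>
      \<Longrightarrow> \<exists>k. stops_at f tol x k \<and> real k \<le> K * L / tol\<^sup>2"
    by metis
  show ?thesis
  proof (intro exI[of _ "2 + 2 * K"] conjI allI impI)
    show "0 < 2 + 2 * K"
      using \<open>0 \<le> K\<close> by simp
    fix f :: "real ^ 'n \<Rightarrow> real" and L tol x0 x t
    assume f: "local_descent f V L" "1 \<le> L" "0 < tol" "tol \<le> 1" "f x0 \<le> V"
      "steepest_descent_run S f tol x0 x t"
    from K[OF this] obtain k where k: "stops_at f tol x k" "real k \<le> K * L / tol\<^sup>2"
      by blast
    have "real (evaluations t k) \<le> 2 + 2 * real k"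
      using of_nat_mono[OF evaluations_le[of t k], where 'a = real] by simp
    moreover have "1 \<le> L / tol\<^sup>2"
      using f power_le_one[of tol 2] by simp
    ultimately have "real (evaluations t k) \<le> (2 + 2 * K) * L / tol\<^sup>2"
      using k(2) by (simp add: distrib_right add_divide_distrib)
    with k(1) show "\<exists>k. stops_at f tol x k \<and> real (evaluations t k) \<le> (2 + 2 * K) * L / tol\<^sup>2"
      by blast
  qed
qed

section \<open>The min-max problem\<close>

theorem theorem4p4:
  fixes F :: "real ^ 'n \<Rightarrow> real ^ 'm"
    and F' :: "real ^ 'n \<Rightarrow> real ^ 'n ^ 'm"
    and C Q :: "real ^ 'r ^ 'm"
    and R :: "real ^ 'r ^ 'r"
    and x0 :: "real ^ 'n"
    and L1 L2 \<delta>max :: real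
    and S :: safeguard
  assumes "\<And>x. (F has_derivative (\<lambda>h. F' x *v h)) (at x)"
    and "continuous_on UNIV F'"
    and "L1-lipschitz_on UNIV (\<lambda>x. transpose (F' x) *v F x)"
    and "L2-lipschitz_on UNIV F'"
    and "CARD('r) \<le> CARD('m)"
    and "rank C = CARD('r)"
    and "C = Q ** R"
    and "transpose Q ** Q = mat 1"
    and "\<And>i j. i \<noteq> j \<Longrightarrow> R $ i $ j = 0"
    and "\<And>i. 0 < R $ i $ i"
    and "0 < \<delta>max"
    and "admissible S"
  shows "\<exists>K>0. \<forall>\<epsilon> \<delta>. 0 < \<epsilon> \<and> \<epsilon> \<le> 1 \<and> 0 < \<delta> \<and> \<delta> \<le> \<delta>max \<longrightarrow>
    (let \<mu> = \<epsilon> / (8 * real CARD('r) * \<delta>); f = (\<lambda>x. Psi F C \<delta> x \<mu>) in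
     \<forall>x t. steepest_descent_run S f (\<epsilon> / 2) x0 x t \<longrightarrow>
       (\<exists>k. stops_at f (\<epsilon> / 2) x k \<and>
            real (evaluations t k) \<le> K * (1 / \<epsilon>\<^sup>2 + \<delta>\<^sup>2 / \<epsilon> ^ 3) \<and>
            (\<exists>y. is_arg_max (\<lambda>y. norm (transpose C *v (F (x k) - C *v y))) (\<lambda>y. infnorm y \<le> \<delta>) y) \<and>
            (\<forall>y. is_arg_max (\<lambda>y. norm (transpose C *v (F (x k) - C *v y))) (\<lambda>y. infnorm y \<le> \<delta>) y
               \<longrightarrow> eps_minimax_critical F F' C \<delta> \<epsilon> (x k) y)))"
proof -
  \<comment> \<open>\<open>V\<close> bounds the initial value \<open>f x0\<close> for all admitted \<open>\<epsilon>\<close> and \<open>\<delta>\<close>; the summand 1 covers the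
    smoothing error \<open>\<epsilon>/2\<close> and ensures \<open>V \<le> V\<^sup>2\<close>, so that \<open>V\<close> also bounds \<open>norm (F x)\<close> on the sublevel set.\<close>
  define r where "r = real CARD('r)"
  define V where "V = (norm (F x0))\<^sup>2 + 2 * \<delta>max * norm1 (transpose C *v F x0) + 1"
  define M where "M = 1 + 2 * L2 + L1 + L2 * V + L2\<^sup>2"
  define A where "A = 1 + 2 * L1 + 2 * \<delta>max * (r * norm C * L2)"
  define D where "D = 4 * r * (norm C * (M + L2))\<^sup>2"
  have L: "0 \<le> L1" "0 \<le> L2"
    using assms(3,4) by (auto intro: lipschitz_on_nonneg)
  have r: "0 < r"
    by (simp add: r_def)
  have norm1: "0 \<le> norm1 (transpose C *v F x0)"
    unfolding norm1_def by (rule sum_nonneg) simp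
  have V: "1 \<le> V"
    using norm1 \<open>0 < \<delta>max\<close> by (simp add: V_def)
  then have "0 \<le> V"
    by simp
  have A: "1 \<le> A" and D: "0 \<le> D"
    using L r \<open>0 < \<delta>max\<close> by (simp_all add: A_def D_def)
  obtain K where "0 < K"
    and K: "\<And>(f :: real ^ 'n \<Rightarrow> real) L tol x0 x t.
      \<lbrakk>local_descent f V L; 1 \<le> L; 0 < tol; tol \<le> 1; f x0 \<le> V; steepest_descent_run S f tol x0 x t\<rbrakk>
      \<Longrightarrow> \<exists>k. stops_at f tol x k \<and> real (evaluations t k) \<le> K * L / tol\<^sup>2"
    using steepest_descent_complexity[OF \<open>admissible S\<close> \<open>0 \<le> V\<close>] by metis
  show ?thesis
    unfolding Let_def
  proof (intro exI[of _ "4 * K * (A + D)"] conjI allI impI; (elim conjE)?)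
    show "0 < 4 * K * (A + D)"
      using \<open>0 < K\<close> A D by simp
  next
    fix \<epsilon> \<delta> :: real and x :: "nat \<Rightarrow> real ^ 'n" and t :: "nat \<Rightarrow> real"
    assume \<epsilon>: "0 < \<epsilon>" "\<epsilon> \<le> 1" and \<delta>: "0 < \<delta>" "\<delta> \<le> \<delta>max"
    define \<mu> where "\<mu> = \<epsilon> / (8 * real CARD('r) * \<delta>)"
    define f where "f = (\<lambda>x. Psi F C \<delta> x \<mu>)"
    define L where "L = A + D * \<delta>\<^sup>2 / \<epsilon>"
    have "0 < \<mu>" and smoothing: "4 * \<delta> * r * \<mu> = \<epsilon> / 2"
      using \<epsilon> \<delta> by (auto simp: \<mu>_def r_def)
    have f_ge: "(norm (F x))\<^sup>2 \<le> f x" for x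
    proof -
      have "0 \<le> (\<Sum>i\<in>UNIV. theta ((transpose C *v F x) $ i) \<mu>)"
        by (rule sum_nonneg) (simp add: theta_def)
      then show ?thesis
        using \<delta> by (simp only: f_def Psi_def) simp
    qed
    have descent: "local_descent f V L"
      unfolding local_descent_def
    proof (intro conjI allI impI)
      show "0 \<le> f x" for x
        using f_ge[of x] by (meson order_trans zero_le_power2)
    next
      fix x s :: "real ^ 'n"
      assume "f x \<le> V" "norm s \<le> 1"
      have "norm (F x) \<le> V"
      proof (rule power2_le_imp_le)
        have "(norm (F x))\<^sup>2 \<le> V * 1"
          using f_ge[of x] \<open>f x \<le> V\<close> by simp
        also have "\<dots> \<le> V\<^sup>2"
          using V unfolding power2_eq_square by (intro mult_left_mono) auto
        finally show "(norm (F x))\<^sup>2 \<le> V\<^sup>2" .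
      qed (use V in simp)
      then have "norm (F' x *v v) \<le> M * norm v" for v
        unfolding M_def by (rule jacobian_bounded_where_residual_bounded[OF assms(1,3,4)])
      from Psi_local_descent[OF assms(1,3,4) this \<open>0 < \<mu>\<close> _ \<open>norm s \<le> 1\<close>, of \<delta> C] \<delta>
      have step: "f (x + s) \<le> f x + gradient f x \<bullet> s
          + (2 * L1 + 2 * \<delta> * (r * norm C * L2 + (norm C * (M + L2))\<^sup>2 / (4 * \<mu>))) * (norm s)\<^sup>2"
        by (simp add: f_def r_def)
      have "2 * \<delta> * ((norm C * (M + L2))\<^sup>2 / (4 * \<mu>)) = D * \<delta>\<^sup>2 / \<epsilon>"
        using \<epsilon> \<delta> by (simp add: \<mu>_def D_def r_def power2_eq_square)
      moreover have "2 * \<delta> * (r * norm C * L2) \<le> 2 * \<delta>max * (r * norm C * L2)"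
        using \<delta> r \<open>0 \<le> L2\<close> by (intro mult_right_mono) auto
      ultimately have "2 * L1 + 2 * \<delta> * (r * norm C * L2 + (norm C * (M + L2))\<^sup>2 / (4 * \<mu>)) \<le> L"
        unfolding L_def A_def distrib_left[of "2 * \<delta>"] by linarith
      from mult_right_mono[OF this, of "(norm s)\<^sup>2"] step
      show "f (x + s) \<le> f x + gradient f x \<bullet> s + L * (norm s)\<^sup>2"
        by (simp del: distrib_left_numeral)
    qed
    have start: "f x0 \<le> V"
    proof -
      have "(\<Sum>i\<in>UNIV. theta ((transpose C *v F x0) $ i) \<mu>)
          \<le> (\<Sum>i\<in>UNIV. \<bar>(transpose C *v F x0) $ i\<bar> + 2 * \<mu>)"
        by (intro sum_mono theta_bounds \<open>0 < \<mu>\<close>)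
      also have "\<dots> = norm1 (transpose C *v F x0) + 2 * r * \<mu>"
        by (simp add: norm1_def sum.distrib r_def)
      finally have "2 * \<delta> * (\<Sum>i\<in>UNIV. theta ((transpose C *v F x0) $ i) \<mu>)
          \<le> 2 * \<delta> * (norm1 (transpose C *v F x0) + 2 * r * \<mu>)"
        using \<delta> by (intro mult_left_mono) auto
      also have "\<dots> = 2 * \<delta> * norm1 (transpose C *v F x0) + 4 * \<delta> * r * \<mu>"
        by (simp add: distrib_left)
      also have "\<dots> \<le> 2 * \<delta>max * norm1 (transpose C *v F x0) + 1"
        unfolding smoothing using \<epsilon> \<delta> norm1 by (intro add_mono mult_right_mono) auto
      finally show ?thesis
        by (simp only: f_def Psi_def V_def)
    qed
    have "1 \<le> L"
      unfolding L_def using A D \<epsilon> by (simp add: add_increasing2)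
    assume "steepest_descent_run S (\<lambda>x. Psi F C \<delta> x (\<epsilon> / (8 * real CARD('r) * \<delta>))) (\<epsilon> / 2) x0 x t"
    then have "steepest_descent_run S f (\<epsilon> / 2) x0 x t"
      by (simp only: f_def \<mu>_def)
    from K[OF descent \<open>1 \<le> L\<close> _ _ start this] \<epsilon> obtain k
      where stop: "stops_at f (\<epsilon> / 2) x k"
        and cost: "real (evaluations t k) \<le> K * L / (\<epsilon> / 2)\<^sup>2"
      by auto
    note cost
    also have "K * L / (\<epsilon> / 2)\<^sup>2 = 4 * K * (A * (1 / \<epsilon>\<^sup>2) + D * (\<delta>\<^sup>2 / \<epsilon> ^ 3))"
      using \<epsilon> by (simp add: L_def distrib_left add_divide_distrib power2_eq_square power3_eq_cube mult_ac)
    also have "\<dots> \<le> 4 * K * ((A + D) * (1 / \<epsilon>\<^sup>2) + (A + D) * (\<delta>\<^sup>2 / \<epsilon> ^ 3))"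
      using \<open>0 < K\<close> A D \<epsilon> by (intro mult_left_mono add_mono mult_right_mono) auto
    also have "\<dots> = 4 * K * (A + D) * (1 / \<epsilon>\<^sup>2 + \<delta>\<^sup>2 / \<epsilon> ^ 3)"
      by (simp only: distrib_left[symmetric] mult.assoc)
    finally have cost': "real (evaluations t k) \<le> 4 * K * (A + D) * (1 / \<epsilon>\<^sup>2 + \<delta>\<^sup>2 / \<epsilon> ^ 3)" .
    have critical: "eps_minimax_critical F F' C \<delta> \<epsilon> (x k) y"
      if "is_arg_max (\<lambda>y. norm (transpose C *v (F (x k) - C *v y))) (\<lambda>y. infnorm y \<le> \<delta>) y" for y
      using stop by (intro eps_minimax_critical_of_small_gradient[OF assms(1) \<epsilon>(1) \<delta>(1) \<mu>_def _ that])
        (simp add: stops_at_def f_def)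
    show "\<exists>k. stops_at (\<lambda>x. Psi F C \<delta> x (\<epsilon> / (8 * real CARD('r) * \<delta>))) (\<epsilon> / 2) x k \<and>
            real (evaluations t k) \<le> 4 * K * (A + D) * (1 / \<epsilon>\<^sup>2 + \<delta>\<^sup>2 / \<epsilon> ^ 3) \<and>
            (\<exists>y. is_arg_max (\<lambda>y. norm (transpose C *v (F (x k) - C *v y))) (\<lambda>y. infnorm y \<le> \<delta>) y) \<and>
            (\<forall>y. is_arg_max (\<lambda>y. norm (transpose C *v (F (x k) - C *v y))) (\<lambda>y. infnorm y \<le> \<delta>) y
               \<longrightarrow> eps_minimax_critical F F' C \<delta> \<epsilon> (x k) y)"
      using stop[unfolded f_def \<mu>_def] cost' max_residual_attained[of \<delta> C "F (x k)"] \<delta> critical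
      by (intro exI[of _ k] conjI allI impI) auto
  qed
qed

end
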